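(* The local complexity of the class of triangle-free unit-square graphs is $\Theta(n)$, and the local complexity of the class of unit-square graphs is $\Omega(n)$ and $O(n\log n)$.
   Context: A unit-square graph is the graph on a finite point set in the plane with two points adjacent iff their $\ell_\infty$-distance is at most 1. All graphs are finite, simple, connected; $n$ is the number of vertices, with distinct identifiers in $\{1,\dots,\mathrm{poly}(n)\}$. A proof labeling scheme for a class $\mathcal{G}$ consists of a prover assigning a certificate (binary word) to each vertex of each $G\in\mathcal{G}$ and a local verifier where each vertex accepts or rejects based only on identifiers and certificates in its closed neighborhood; all vertices accept when $G\in\mathcal{G}$ with the prover's certificates, and when $G\notin\mathcal{G}$ some vertex rejects for every certificate assignment. The local complexity of $\mathcal{G}$ is the minimum, over such schemes, of the maximum certificate length used on $n$-vertex graphs of $\mathcal{G}$. *)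

theory Defs
  imports Complex_Main "HOL-Library.Landau_Symbols"
begin

text \<open>A graph is given by its vertex set V (the vertex identifiers, natural numbers)
  and a symmetric irreflexive adjacency relation E supported on V.
  The parameter c fixes the polynomial identifier range: identifiers lie in
  {1..n^c}, where n = card V.\<close>

definition graph_ok :: "nat \<Rightarrow> nat set \<Rightarrow> (nat \<Rightarrow> nat \<Rightarrow> bool) \<Rightarrow> bool" where
  "graph_ok c V E \<longleftrightarrow>
     finite V \<and> V \<noteq> {} \<and> V \<subseteq> {1 .. card V ^ c} \<and>
     (\<forall>u v. E u v \<longrightarrow> u \<in> V \<and> v \<in> V) \<and>
     (\<forall>u v. E u v \<longrightarrow> E v u) \<and> (\<forall>u. \<not> E u u) \<and>
     (\<forall>u\<in>V. \<forall>v\<in>V. (u, v) \<in> {(x, y). E x y}\<^sup>*)"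

text \<open>Unit-square graph: realisable by distinct points in the plane with adjacency
  iff l-infinity distance at most 1.\<close>

definition unit_square_graph :: "nat set \<Rightarrow> (nat \<Rightarrow> nat \<Rightarrow> bool) \<Rightarrow> bool" where
  "unit_square_graph V E \<longleftrightarrow>
     (\<exists>p :: nat \<Rightarrow> real \<times> real. inj_on p V \<and>
        (\<forall>u\<in>V. \<forall>v\<in>V. u \<noteq> v \<longrightarrow>
           (E u v \<longleftrightarrow> \<bar>fst (p u) - fst (p v)\<bar> \<le> 1 \<and> \<bar>snd (p u) - snd (p v)\<bar> \<le> 1)))"

definition triangle_free :: "nat set \<Rightarrow> (nat \<Rightarrow> nat \<Rightarrow> bool) \<Rightarrow> bool" where
  "triangle_free V E \<longleftrightarrow> \<not> (\<exists>u\<in>V. \<exists>v\<in>V. \<exists>w\<in>V. E u v \<and> E v w \<and> E u w)"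

definition triangle_free_unit_square_graph :: "nat set \<Rightarrow> (nat \<Rightarrow> nat \<Rightarrow> bool) \<Rightarrow> bool" where
  "triangle_free_unit_square_graph V E \<longleftrightarrow> unit_square_graph V E \<and> triangle_free V E"

text \<open>Local view of vertex v: identifiers and certificates in its closed neighbourhood
  (the partial map is defined exactly on N[v]).\<close>

definition view :: "nat set \<Rightarrow> (nat \<Rightarrow> nat \<Rightarrow> bool) \<Rightarrow> (nat \<Rightarrow> bool list) \<Rightarrow> nat
                     \<Rightarrow> (nat \<Rightarrow> bool list option)" where
  "view V E cert v = (\<lambda>u. if u \<in> V \<and> (u = v \<or> E v u) then Some (cert u) else None)"

text \<open>A proof labeling scheme for class cls: a local verifier A (own identifier,
  view of closed neighbourhood) and a prover P (graph to certificate assignment).\<close>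

definition pls_correct ::
  "(nat set \<Rightarrow> (nat \<Rightarrow> nat \<Rightarrow> bool) \<Rightarrow> bool) \<Rightarrow> nat
   \<Rightarrow> (nat \<Rightarrow> (nat \<Rightarrow> bool list option) \<Rightarrow> bool)
   \<Rightarrow> (nat set \<Rightarrow> (nat \<Rightarrow> nat \<Rightarrow> bool) \<Rightarrow> nat \<Rightarrow> bool list) \<Rightarrow> bool" where
  "pls_correct cls c A P \<longleftrightarrow>
     (\<forall>V E. graph_ok c V E \<longrightarrow> cls V E \<longrightarrow> (\<forall>v\<in>V. A v (view V E (P V E) v))) \<and>
     (\<forall>V E. graph_ok c V E \<longrightarrow> \<not> cls V E \<longrightarrow>
        (\<forall>cert. \<exists>v\<in>V. \<not> A v (view V E cert v)))"

text \<open>Local complexity at n: minimum over correct schemes of the maximum certificate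
  length the prover uses on n-vertex graphs of the class.\<close>

definition local_complexity ::
  "(nat set \<Rightarrow> (nat \<Rightarrow> nat \<Rightarrow> bool) \<Rightarrow> bool) \<Rightarrow> nat \<Rightarrow> nat \<Rightarrow> nat" where
  "local_complexity cls c n =
     (LEAST s. \<exists>A P. pls_correct cls c A P \<and>
        (\<forall>V E. graph_ok c V E \<longrightarrow> card V = n \<longrightarrow> cls V E \<longrightarrow>
           (\<forall>v\<in>V. length (P V E v) \<le> s)))"

end

theory Submission
  imports Defs "HOL-Library.FuncSet"
begin

text \<open>Upper bounds. If an isomorphism-invariant class has a code of length \<open>L\<close> for its \<open>n\<close>-vertex graphs up to
  isomorphism, then \<open>O(L + log n)\<close> bits suffice: every vertex receives the code and its own image in the encoded
  graph, and the verifier checks that the images form a covering map with one fibre of size 1. A unit-square graph is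
  determined by the ranks of the numbers \<open>x\<close> and \<open>x + 1\<close> in each coordinate. In the triangle-free case every cell of
  the unit grid contains at most two points, so a closed walk through all vertices that records the displacement and the
  relative neighbourhood at each step is a code of linear length.

  Lower bound. We use a fooling set of graphs with a cut of constant size. In a unit-square realisation every
  straight ladder of 4-cycles is monotone in both coordinates, and this orientation propagates from one ladder to the
  next. A long ladder forces the sum of the coordinates of its end to be about \<open>2 N\<close>; a path of length \<open>N\<close> between the same
  end points then runs along the diagonal, up to a constant error, and so do any two such paths. One side of the cut
  attaches teeth to one of the two paths, the other side hangs patches from the other path, both between the two paths;
  a tooth and a patch at the same place have to cross.\<close>

section \<open>Encodings of numbers and lists\<close>

text \<open>The obstacle to the lower bound is that realisations are flexible: a ladder fixes the
  directions of its steps but not their lengths, so two long paths between the same ends might drift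
  apart by an amount linear in \<open>n\<close>, and gadgets attached to them would not have to
  meet. The remedy is to play two extremes against each other, a ladder at its shortest and a path
  at its longest. The remaining error is an absolute constant, so gadgets of constant size work, and
  linearly many of them fit into \<open>n\<close> vertices; their sizes 100, 212 and 424 are
  dictated by that error. Each bit chooses one of two places for a tooth and the complementary place
  for a patch, so that two strings that differ, in either direction, make a tooth and a patch
  coincide. In the general upper bound the factor \<open>log n\<close> is the cost of writing a rank
  in binary: without triangle-freeness a grid cell may hold arbitrarily many points, and the
  alphabet of the walk code is no longer finite.\<close>

fun bits :: "nat \<Rightarrow> bool list" where
  "bits n = (if n = 0 then [] else odd n # bits (n div 2))"

declare bits.simps [simp del]

fun bits_val :: "bool list \<Rightarrow> nat" where
  "bits_val [] = 0"
| "bits_val (b # bs) = of_bool b + 2 * bits_val bs"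

lemma bits_val_bits: "bits_val (bits n) = n"
proof (induction n rule: bits.induct)
  case (1 n)
  show ?case
  proof (cases "n = 0")
    case True then show ?thesis by (simp add: bits.simps)
  next
    case False
    then have "bits_val (bits n) = of_bool (odd n) + 2 * (n div 2)"
      using 1 by (subst bits.simps) simp
    then show ?thesis by (cases "even n") auto
  qed
qed

lemma bits_inject [simp]: "bits m = bits n \<longleftrightarrow> m = n"
  by (metis bits_val_bits)

lemma length_bits_le: "n < 2 ^ k \<Longrightarrow> length (bits n) \<le> k"
proof (induction k arbitrary: n)
  case 0 then show ?case by (simp add: bits.simps)
next
  case (Suc k)
  show ?case
  proof (cases "n = 0")
    case True then show ?thesis by (simp add: bits.simps)
  next
    case False
    have "n div 2 < 2 ^ k" using Suc.prems by auto
    from Suc.IH [OF this] show ?thesis using False by (subst bits.simps) simp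
  qed
qed

lemma less_two_power_length_bits: "n < 2 ^ length (bits n)"
proof (induction n rule: bits.induct)
  case (1 n)
  show ?case
  proof (cases "n = 0")
    case True then show ?thesis by (simp add: bits.simps)
  next
    case False
    then have "n div 2 < 2 ^ length (bits (n div 2))" using 1 by simp
    with False show ?thesis by (subst bits.simps) simp
  qed
qed

lemma length_bits_mono: "m \<le> n \<Longrightarrow> length (bits m) \<le> length (bits n)"
  by (meson le_less_trans length_bits_le less_two_power_length_bits)

lemma length_bits_le_self: "length (bits n) \<le> n"
  by (rule length_bits_le) (rule less_exp)

lemma length_bits_le_power: 
  assumes "r \<le> n ^ c" "c \<ge> 1"
  shows "length (bits r) \<le> c * length (bits n)"
proof (rule length_bits_le)
  have "n ^ c < (2 ^ length (bits n)) ^ c"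
    using less_two_power_length_bits assms(2) by (intro power_strict_mono) auto
  with assms(1) show "r < 2 ^ (c * length (bits n))"
    by (simp add: power_mult [symmetric] mult.commute)
qed

text \<open>A prefix code: a flag before every bit announces that another bit follows, so
  concatenated words can be separated at the price of doubling their length.\<close>

fun dbl :: "bool list \<Rightarrow> bool list" where
  "dbl [] = [False]"
| "dbl (b # bs) = True # b # dbl bs"

lemma dbl_append_eq [simp]: "dbl a @ x = dbl b @ y \<longleftrightarrow> a = b \<and> x = y"
proof (induction a arbitrary: b)
  case Nil then show ?case by (cases b) auto
next
  case (Cons u a) then show ?case by (cases b) auto
qed

lemma length_dbl [simp]: "length (dbl a) = 2 * length a + 1"
  by (induction a) auto

definition encode_nats :: "nat list \<Rightarrow> bool list" where
  "encode_nats ns = concat (map (dbl \<circ> bits) ns)"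

lemma dbl_neq_Nil [simp]: "dbl a \<noteq> []"
  by (cases a) simp_all

lemma encode_nats_inject: "encode_nats ms = encode_nats ns \<Longrightarrow> ms = ns"
proof (induction ms arbitrary: ns)
  case Nil then show ?case by (cases ns) (auto simp: encode_nats_def)
next
  case (Cons m ms) then show ?case by (cases ns) (auto simp: encode_nats_def)
qed

lemma length_encode_nats:
  assumes "\<And>a. a \<in> set ns \<Longrightarrow> length (bits a) \<le> k"
  shows "length (encode_nats ns) \<le> length ns * (2 * k + 1)"
  using assms
proof (induction ns)
  case Nil then show ?case by (simp add: encode_nats_def)
next
  case (Cons a ns)
  have "length (bits a) \<le> k" "length (encode_nats ns) \<le> length ns * (2 * k + 1)"
    using Cons by auto
  then show ?case by (simp add: encode_nats_def)
qed

text \<open>The last component needs no delimiter. The lengths add up to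
  \<open>2 * L + 3 * c * length (bits n) + 2\<close> below, because the two identifiers cost
  \<open>2 + 1\<close> times \<open>c * length (bits n)\<close>.\<close>

definition pack :: "bool list \<Rightarrow> nat \<Rightarrow> nat \<Rightarrow> bool list" where
  "pack w r i = dbl w @ dbl (bits r) @ bits i"

lemma pack_inject [simp]: "pack w r i = pack w' r' i' \<longleftrightarrow> w = w' \<and> r = r' \<and> i = i'"
  by (simp add: pack_def)

section \<open>Proof labeling schemes from codes of graphs\<close>

definition graph_iso ::
  "nat set \<Rightarrow> (nat \<Rightarrow> nat \<Rightarrow> bool) \<Rightarrow> nat set \<Rightarrow> (nat \<Rightarrow> nat \<Rightarrow> bool) \<Rightarrow> (nat \<Rightarrow> nat) \<Rightarrow> bool" where
  "graph_iso V E V' E' f \<longleftrightarrow>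
     bij_betw f V V' \<and> (\<forall>u\<in>V. \<forall>v\<in>V. E u v \<longleftrightarrow> E' (f u) (f v))"

lemma graph_ok_edge:
  assumes "graph_ok c V E" "E u v"
  shows "u \<in> V" "v \<in> V" "E v u" "u \<noteq> v"
  using assms unfolding graph_ok_def by blast+

lemma graph_ok_connected_induct:
  assumes "graph_ok c V E" "a \<in> V" "Q a"
    and "\<And>u v. Q u \<Longrightarrow> E u v \<Longrightarrow> Q v" and "b \<in> V"
  shows "Q b"
proof -
  have "(a, b) \<in> {(x, y). E x y}\<^sup>*" using assms(1,2,5) by (auto simp: graph_ok_def)
  then show ?thesis using assms(3,4) by (induction rule: rtrancl_induct) auto
qed

text \<open>A map that is bijective on neighbourhoods is a covering; the fibres over a connected graph
  all have the size of the fibre over one vertex.\<close>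

lemma cover_graph_iso:
  assumes G: "graph_ok c V E" and H: "graph_ok c V' E'"
    and cov: "\<And>v. v \<in> V \<Longrightarrow> g v \<in> V'"
    and nb: "\<And>v. v \<in> V \<Longrightarrow> bij_betw g {u. E v u} {j. E' (g v) j}"
    and h: "h \<in> V'" and fib: "\<And>u v. u \<in> V \<Longrightarrow> v \<in> V \<Longrightarrow> g u = h \<Longrightarrow> g v = h \<Longrightarrow> u = v"
  shows "graph_iso V E V' E' g"
proof -
  have EV: "u \<in> V \<and> v \<in> V" "E v u" if "E u v" for u v using graph_ok_edge [OF G that] by auto
  have EV': "u \<in> V' \<and> v \<in> V'" "E' v u" if "E' u v" for u v using graph_ok_edge [OF H that] by auto
  obtain v0 where v0: "v0 \<in> V" using G by (auto simp: graph_ok_def)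
  have lift: "\<exists>u. E v u \<and> g u = j" if "v \<in> V" "E' (g v) j" for v j
  proof -
    have "j \<in> g ` {u. E v u}" using nb [OF that(1)] that(2) by (simp add: bij_betw_def)
    then show ?thesis by blast
  qed
  have inj1: "u = u'" if "E v u" "E v u'" "g u = g u'" for v u u'
    using nb [of v] EV that by (auto simp: bij_betw_def inj_on_def)
  have fwd: "E' (g v) (g u)" if "E v u" for u v
    using nb [of v] EV [OF that] that by (auto simp: bij_betw_def)
  have surj: "\<exists>v\<in>V. g v = j" if "j \<in> V'" for j
  proof (rule graph_ok_connected_induct [OF H, of "g v0" "\<lambda>j. \<exists>v\<in>V. g v = j"])
    fix i j assume "\<exists>v\<in>V. g v = i" "E' i j"
    then show "\<exists>v\<in>V. g v = j" using lift EV by metis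
  qed (use v0 cov that in auto)
  have "\<forall>u\<in>V. \<forall>v\<in>V. g u = j \<longrightarrow> g v = j \<longrightarrow> u = v" if "j \<in> V'" for j
  proof (rule graph_ok_connected_induct [OF H h, of "\<lambda>j. \<forall>u\<in>V. \<forall>v\<in>V. g u = j \<longrightarrow> g v = j \<longrightarrow> u = v"])
    fix i j assume i: "\<forall>u\<in>V. \<forall>v\<in>V. g u = i \<longrightarrow> g v = i \<longrightarrow> u = v" and ij: "E' i j"
    show "\<forall>u\<in>V. \<forall>v\<in>V. g u = j \<longrightarrow> g v = j \<longrightarrow> u = v"
    proof (intro ballI impI)
      fix u v assume uv: "u \<in> V" "v \<in> V" "g u = j" "g v = j"
      \<comment> \<open>The neighbours of \<open>u\<close> and \<open>v\<close> over
        \<open>i\<close> are one vertex by hypothesis, and \<open>g\<close> is injective on the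
        neighbourhood of that vertex.\<close>
      obtain a where a: "E u a" "g a = i" using lift [of u i] uv EV' [OF ij] by auto
      obtain b where b: "E v b" "g b = i" using lift [of v i] uv EV' [OF ij] by auto
      have "a = b" using i a b EV by blast
      then show "u = v" using inj1 [of a u v] a b EV uv by auto
    qed
  qed (use that fib in auto)
  then have "inj_on g V" using cov by (auto simp: inj_on_def)
  moreover have "g ` V = V'" using cov surj by auto
  moreover have "E u v" if uv: "u \<in> V" "v \<in> V" "E' (g u) (g v)" for u v
  proof -
    obtain w where "E u w" "g w = g v" using lift [OF uv(1,3)] by auto
    then show ?thesis using \<open>inj_on g V\<close> EV uv by (metis inj_onD)
  qed
  ultimately show ?thesis using fwd by (auto simp: graph_iso_def bij_betw_def)
qed

text \<open>The certificate of \<open>v\<close> consists of the code \<open>w\<close> of the graph, the image of \<open>v\<close> under an isomorphism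
  onto a graph \<open>dec w\<close> that depends on \<open>w\<close> only, and the identifier \<open>r\<close> of the vertex mapped to a fixed
  vertex \<open>root w\<close>. Checking that \<open>r\<close> alone is mapped to \<open>root w\<close> replaces counting the vertices.\<close>

lemma pls_from_code:
  fixes cls :: "nat set \<Rightarrow> (nat \<Rightarrow> nat \<Rightarrow> bool) \<Rightarrow> bool"
    and enc :: "nat set \<Rightarrow> (nat \<Rightarrow> nat \<Rightarrow> bool) \<Rightarrow> bool list"
  assumes c: "c \<ge> 1"
    and inv: "\<And>V E V' E' f. cls V' E' \<Longrightarrow> graph_iso V E V' E' f \<Longrightarrow> cls V E"
    and code: "\<And>V E V' E'. \<lbrakk>graph_ok c V E; cls V E; graph_ok c V' E'; cls V' E';
                 enc V E = enc V' E'\<rbrakk> \<Longrightarrow> \<exists>f. graph_iso V E V' E' f"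
    and len: "\<And>V E. \<lbrakk>graph_ok c V E; cls V E\<rbrakk> \<Longrightarrow> length (enc V E) \<le> L (card V)"
  shows "\<exists>A P. pls_correct cls c A P \<and>
    (\<forall>V E. graph_ok c V E \<longrightarrow> cls V E \<longrightarrow>
       (\<forall>v\<in>V. length (P V E v) \<le> 2 * L (card V) + 3 * c * length (bits (card V)) + 2))"
proof -
  define good where "good w G \<longleftrightarrow> graph_ok c (fst G) (snd G) \<and> cls (fst G) (snd G) \<and> enc (fst G) (snd G) = w"
    for w and G :: "nat set \<times> (nat \<Rightarrow> nat \<Rightarrow> bool)"
  define dec where "dec w = (SOME G. good w G)" for w
  define root where "root w = (SOME h. h \<in> fst (dec w))" for w
  \<comment> \<open>The quantifiers only decode certificates: as \<open>pack\<close> is injective,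
    \<open>w\<close>, \<open>r\<close> and the values of \<open>g\<close> on the closed
    neighbourhood are determined by the view. The condition \<open>good w (dec w)\<close> rejects
    words that encode no graph of the class.\<close>
  define A where "A v vw \<longleftrightarrow> (\<exists>w r g. good w (dec w) \<and> g v \<in> fst (dec w) \<and> (g v = root w \<longrightarrow> v = r) \<and>
      (\<forall>u\<in>dom vw. vw u = Some (pack w r (g u))) \<and>
      bij_betw g (dom vw - {v}) {j. snd (dec w) (g v) j})"
    for v :: nat and vw :: "nat \<Rightarrow> bool list option"
  define isom where "isom V E = (SOME f. graph_iso V E (fst (dec (enc V E))) (snd (dec (enc V E))) f)" for V E
  define P where "P V E v = pack (enc V E) (inv_into V (isom V E) (root (enc V E))) (isom V E v)" for V E v
  have root: "root w \<in> fst (dec w)" if "good w (dec w)" for w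
    using that unfolding good_def graph_ok_def root_def by (metis ex_in_conv someI_ex)
  have dom: "dom (view V E ce v) - {v} = {u. E v u}" if "graph_ok c V E" "v \<in> V" for V E ce v
  proof -
    have "\<not> E v v" "{u. E v u} \<subseteq> V" using graph_ok_edge(2,4) [OF that(1)] by blast+
    then show ?thesis using that(2) by (auto simp: view_def dom_def split: if_splits)
  qed
  have yes: "good (enc V E) (dec (enc V E)) \<and>
      graph_iso V E (fst (dec (enc V E))) (snd (dec (enc V E))) (isom V E)"
    if "graph_ok c V E" "cls V E" for V E
  proof -
    have "good (enc V E) (V, E)" using that by (simp add: good_def)
    then have g: "good (enc V E) (dec (enc V E))" unfolding dec_def by (rule someI)
    then have "\<exists>f. graph_iso V E (fst (dec (enc V E))) (snd (dec (enc V E))) f"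
      using that code [of V E "fst (dec (enc V E))" "snd (dec (enc V E))"] by (auto simp: good_def)
    then show ?thesis using g unfolding isom_def by (metis someI_ex)
  qed
  have complete: "A v (view V E (P V E) v)" if G: "graph_ok c V E" "cls V E" "v \<in> V" for V E v
  proof -
    define w where "w = enc V E"
    define f where "f = isom V E"
    have y: "good w (dec w)" "graph_iso V E (fst (dec w)) (snd (dec w)) f"
      using yes [OF G(1,2)] by (auto simp: w_def f_def)
    have f: "bij_betw f V (fst (dec w))" using y(2) by (simp add: graph_iso_def)
    have nbV: "{u. E v u} \<subseteq> V" using graph_ok_edge(2) [OF G(1)] by blast
    have "bij_betw f {u. E v u} {j. snd (dec w) (f v) j}"
      unfolding bij_betw_def
    proof
      show "inj_on f {u. E v u}" 
        using f nbV by (auto simp: bij_betw_def intro: inj_on_subset)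
      show "f ` {u. E v u} = {j. snd (dec w) (f v) j}"
      proof (intro equalityI subsetI)
        fix j assume "j \<in> f ` {u. E v u}"
        then obtain u where u: "E v u" "j = f u" by blast
        then show "j \<in> {j. snd (dec w) (f v) j}"
          using y(2) G(3) graph_ok_edge(2) [OF G(1) u(1)] by (simp add: graph_iso_def)
      next
        fix j assume j: "j \<in> {j. snd (dec w) (f v) j}"
        then have "j \<in> fst (dec w)" using y(1) graph_ok_edge(2) unfolding good_def by blast
        then have "j \<in> f ` V" using f by (simp add: bij_betw_def)
        then obtain u where "u \<in> V" "f u = j" by blast
        then show "j \<in> f ` {u. E v u}" using y(2) G j by (auto simp: graph_iso_def)
      qed
    qed
    moreover have "f v = root w \<longrightarrow> v = inv_into V f (root w)"
      using f G by (metis bij_betw_inv_into_left)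
    moreover have "f v \<in> fst (dec w)" using f G by (auto simp: bij_betw_def)
    moreover have "\<forall>u\<in>dom (view V E (P V E) v).
        view V E (P V E) v u = Some (pack w (inv_into V f (root w)) (f u))"
      by (auto simp: P_def w_def f_def view_def split: if_splits)
    ultimately show ?thesis unfolding A_def dom [OF G(1,3), of "P V E"]
      using y(1) by (intro exI [of _ w] exI [of _ "inv_into V f (root w)"] exI [of _ f] conjI)
  qed
  have sound: "cls V E" if G: "graph_ok c V E" and acc: "\<And>v. v \<in> V \<Longrightarrow> A v (view V E ce v)" for V E ce
  proof -
    have nbV: "{u. E v u} \<subseteq> V" for v using graph_ok_edge(2) [OF G] by blast
    have "\<exists>w r g. good w (dec w) \<and> g v \<in> fst (dec w) \<and> (g v = root w \<longrightarrow> v = r) \<and>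
      (\<forall>u. u = v \<or> E v u \<longrightarrow> ce u = pack w r (g u)) \<and> bij_betw g {u. E v u} {j. snd (dec w) (g v) j}"
      if v: "v \<in> V" for v
    proof -
      have *: "dom (view V E ce v) = insert v {u. E v u}"
        using v nbV [of v] by (auto simp: view_def dom_def split: if_splits)
      from acc [OF v] obtain w r g where "good w (dec w)" "g v \<in> fst (dec w)" "g v = root w \<longrightarrow> v = r"
        "\<forall>u\<in>dom (view V E ce v). view V E ce v u = Some (pack w r (g u))"
        "bij_betw g (dom (view V E ce v) - {v}) {j. snd (dec w) (g v) j}"
        unfolding A_def by blast
      moreover have "view V E ce v u = Some (ce u)" if "u = v \<or> E v u" for u
        using that v nbV [of v] by (auto simp: view_def)
      ultimately show ?thesis using dom [OF G v, of ce] *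
        by (intro exI [of _ w] exI [of _ r] exI [of _ g]) auto
    qed
    then obtain W R g where loc: "\<And>v. v \<in> V \<Longrightarrow> good (W v) (dec (W v)) \<and> g v v \<in> fst (dec (W v)) \<and>
       (g v v = root (W v) \<longrightarrow> v = R v) \<and>
      (\<forall>u. u = v \<or> E v u \<longrightarrow> ce u = pack (W v) (R v) (g v u)) \<and> bij_betw (g v) {u. E v u} {j. snd (dec (W v)) (g v v) j}"
      by metis
    obtain v0 where v0: "v0 \<in> V" using G by (auto simp: graph_ok_def)
    define w where "w = W v0"
    define r where "r = R v0"
    define k where "k v = g v v" for v
    have ce: "ce v = pack (W v) (R v) (k v)" if "v \<in> V" for v using loc [OF that] by (auto simp: k_def)
    have ce': "ce u = pack (W v) (R v) (g v u)" if "v \<in> V" "E v u" for u v using loc [OF that(1)] that by auto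
    have EV: "u \<in> V" "v \<in> V" if "E u v" for u v using graph_ok_edge [OF G that] by auto
    \<comment> \<open>The certificate of \<open>u\<close> is decoded by \<open>u\<close> and by its
      neighbour \<open>v\<close>, with the same result since \<open>pack\<close> is injective. This
      merges the local choices into global ones.\<close>
    have same: "W u = W v" "R u = R v" "g v u = k u" if "E v u" for u v
      using ce' [of v u] ce [of u] EV [OF that] that by auto
    have WR: "W v = w \<and> R v = r" if "v \<in> V" for v
    proof (rule graph_ok_connected_induct [OF G v0 _ _ that])
      show "W v0 = w \<and> R v0 = r" by (simp add: w_def r_def)
    qed (use same in auto)
    have "graph_iso V E (fst (dec w)) (snd (dec w)) k"
    proof (rule cover_graph_iso [OF G])
      show "graph_ok c (fst (dec w)) (snd (dec w))"
        using loc [OF v0] by (auto simp: good_def w_def)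
      show "k v \<in> fst (dec w)" if "v \<in> V" for v
        using loc [OF that] WR [OF that] by (auto simp: k_def)
      show "root w \<in> fst (dec w)" using root loc [OF v0] by (auto simp: w_def)
      show "u = v" if "u \<in> V" "v \<in> V" "k u = root w" "k v = root w" for u v
        using loc [OF that(1)] loc [OF that(2)] WR that by (auto simp: k_def)
      show "bij_betw k {u. E v u} {j. snd (dec w) (k v) j}" if v: "v \<in> V" for v
      proof -
        have "bij_betw (g v) {u. E v u} {j. snd (dec w) (k v) j}"
          using loc [OF v] WR [OF v] by (auto simp: k_def)
        then show ?thesis using same(3) by (subst bij_betw_cong [of _ _ "g v"]) auto
      qed
    qed
    then show ?thesis using inv loc [OF v0] by (auto simp: good_def w_def)
  qed
  have "length (P V E v) \<le> 2 * L (card V) + 3 * c * length (bits (card V)) + 2"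
    if G: "graph_ok c V E" "cls V E" "v \<in> V" for V E v
  proof -
    define w where "w = enc V E"
    have y: "good w (dec w)" "graph_iso V E (fst (dec w)) (snd (dec w)) (isom V E)"
      using yes [OF G(1,2)] by (auto simp: w_def)
    have f: "bij_betw (isom V E) V (fst (dec w))" using y(2) by (simp add: graph_iso_def)
    have sub: "\<And>u. u \<in> V \<Longrightarrow> u \<le> card V ^ c" using G by (auto simp: graph_ok_def)
    have "\<And>u. u \<in> fst (dec w) \<Longrightarrow> u \<le> card V ^ c"
      using y(1) bij_betw_same_card [OF f] by (auto simp: good_def graph_ok_def)
    then have 1: "length (bits (isom V E v)) \<le> c * length (bits (card V))"
      using f G(3) c by (intro length_bits_le_power) (auto simp: bij_betw_def)
    have "inv_into V (isom V E) (root w) \<in> V"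
      using f root [OF y(1)] by (intro inv_into_into) (auto simp: bij_betw_def)
    then have 2: "length (bits (inv_into V (isom V E) (root w))) \<le> c * length (bits (card V))"
      using sub c by (intro length_bits_le_power) auto
    show ?thesis using 1 2 len [OF G(1,2)] by (simp add: P_def pack_def w_def)
  qed
  then show ?thesis
    using complete sound unfolding pls_correct_def
    by (intro exI [of _ A] exI [of _ P]) metis
qed

section \<open>Codes of unit-square graphs\<close>

text \<open>The lists may repeat vertices, as a covering walk does; therefore coincidences of
  positions have to agree as well as edges.\<close>

lemma graph_iso_lists:
  assumes vs: "set vs = V" and vs': "set vs' = V'" and len: "length vs = length vs'"
    and eq: "\<And>i j. i < length vs \<Longrightarrow> j < length vs \<Longrightarrow> vs ! i = vs ! j \<longleftrightarrow> vs' ! i = vs' ! j"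
    and edge: "\<And>i j. i < length vs \<Longrightarrow> j < length vs \<Longrightarrow> E (vs ! i) (vs ! j) \<longleftrightarrow> E' (vs' ! i) (vs' ! j)"
  shows "\<exists>f. graph_iso V E V' E' f"
proof -
  define f where "f u = vs' ! (SOME k. k < length vs \<and> vs ! k = u)" for u
  have f: "f (vs ! k) = vs' ! k" if "k < length vs" for k
  proof -
    define l where "l = (SOME l. l < length vs \<and> vs ! l = vs ! k)"
    have "l < length vs \<and> vs ! l = vs ! k" unfolding l_def by (rule someI [of _ k]) (use that in auto)
    then show ?thesis using eq that by (auto simp: f_def l_def)
  qed
  have V: "V = (\<lambda>k. vs ! k) ` {..<length vs}" using vs by (auto simp: set_conv_nth)
  have V': "V' = (\<lambda>k. vs' ! k) ` {..<length vs}" using vs' len by (auto simp: set_conv_nth)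
  have "inj_on f V" unfolding V using f eq by (auto simp: inj_on_def)
  moreover have "f ` V = V'" unfolding V V' using f by (auto simp: image_image)
  ultimately have "graph_iso V E V' E' f"
    unfolding graph_iso_def bij_betw_def using f edge by (auto simp: V)
  then show ?thesis by blast
qed

definition realizes :: "nat set \<Rightarrow> (nat \<Rightarrow> nat \<Rightarrow> bool) \<Rightarrow> (nat \<Rightarrow> real \<times> real) \<Rightarrow> bool" where
  "realizes V E p \<longleftrightarrow> (\<forall>u\<in>V. \<forall>v\<in>V. u \<noteq> v \<longrightarrow>
     (E u v \<longleftrightarrow> \<bar>fst (p u) - fst (p v)\<bar> \<le> 1 \<and> \<bar>snd (p u) - snd (p v)\<bar> \<le> 1))"

lemma unit_square_graph_iff_realizes:
  "unit_square_graph V E \<longleftrightarrow> (\<exists>p. inj_on p V \<and> realizes V E p)"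
  by (simp add: unit_square_graph_def realizes_def)

lemma realizesD:
  "realizes V E p \<Longrightarrow> u \<in> V \<Longrightarrow> v \<in> V \<Longrightarrow> u \<noteq> v \<Longrightarrow>
     E u v \<longleftrightarrow> \<bar>fst (p u) - fst (p v)\<bar> \<le> 1 \<and> \<bar>snd (p u) - snd (p v)\<bar> \<le> 1"
  by (simp add: realizes_def)

lemma unit_square_graph_iso:
  assumes "unit_square_graph V' E'" and iso: "graph_iso V E V' E' f"
  shows "unit_square_graph V E"
proof -
  obtain p where p: "inj_on p V'" "realizes V' E' p"
    using assms(1) unfolding unit_square_graph_iff_realizes by blast
  have f: "inj_on f V" "f ` V = V'" "\<And>u v. u\<in>V \<Longrightarrow> v\<in>V \<Longrightarrow> E u v \<longleftrightarrow> E' (f u) (f v)"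
    using iso by (auto simp: graph_iso_def bij_betw_def)
  have "inj_on (p \<circ> f) V" using f p(1) by (auto intro: comp_inj_on)
  moreover have "E u v \<longleftrightarrow> \<bar>fst (p (f u)) - fst (p (f v))\<bar> \<le> 1 \<and> \<bar>snd (p (f u)) - snd (p (f v))\<bar> \<le> 1"
    if "u \<in> V" "v \<in> V" "u \<noteq> v" for u v
    using f realizesD [OF p(2), of "f u" "f v"] that by (auto simp: inj_on_def)
  ultimately show ?thesis unfolding unit_square_graph_def by (intro exI [of _ "p \<circ> f"]) auto
qed

lemma triangle_free_iso:
  assumes "triangle_free V' E'" and iso: "graph_iso V E V' E' f"
  shows "triangle_free V E"
  using assms unfolding triangle_free_def graph_iso_def bij_betw_def by blast

lemma triangle_free_unit_square_graph_iso:
  assumes "triangle_free_unit_square_graph V' E'" and iso: "graph_iso V E V' E' f"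
  shows "triangle_free_unit_square_graph V E"
  using assms unit_square_graph_iso triangle_free_iso
  unfolding triangle_free_unit_square_graph_def by blast

text \<open>Sublevel sets of \<open>g\<close> are nested, so their sizes compare like their
  thresholds; the vertex \<open>v\<close> itself makes the inclusion strict. Thus real coordinates
  can be replaced by integers up to \<open>card V\<close>.\<close>

lemma card_rank_le_iff:
  fixes g :: "nat \<Rightarrow> real"
  assumes "finite V" "v \<in> V"
  shows "card {w\<in>V. g w \<le> g v} \<le> card {w\<in>V. g w \<le> g u + 1} \<longleftrightarrow> g v \<le> g u + 1"
proof
  assume "g v \<le> g u + 1"
  then show "card {w\<in>V. g w \<le> g v} \<le> card {w\<in>V. g w \<le> g u + 1}"
    using assms by (intro card_mono) auto
next
  assume *: "card {w\<in>V. g w \<le> g v} \<le> card {w\<in>V. g w \<le> g u + 1}"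
  show "g v \<le> g u + 1"
  proof (rule ccontr)
    assume "\<not> ?thesis"
    then have "{w\<in>V. g w \<le> g u + 1} \<subset> {w\<in>V. g w \<le> g v}" using assms by auto
    then have "card {w\<in>V. g w \<le> g u + 1} < card {w\<in>V. g w \<le> g v}"
      using assms by (intro psubset_card_mono) auto
    then show False using * by simp
  qed
qed

definition rank_code :: "nat set \<Rightarrow> (nat \<Rightarrow> real \<times> real) \<Rightarrow> nat list" where
  "rank_code V p = (let vs = sorted_list_of_set V in
     map (\<lambda>u. card {w\<in>V. fst (p w) \<le> fst (p u)}) vs @ map (\<lambda>u. card {w\<in>V. fst (p w) \<le> fst (p u) + 1}) vs @
     map (\<lambda>u. card {w\<in>V. snd (p w) \<le> snd (p u)}) vs @ map (\<lambda>u. card {w\<in>V. snd (p w) \<le> snd (p u) + 1}) vs)"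

lemma rank_code_iso:
  fixes p p' :: "nat \<Rightarrow> real \<times> real"
  assumes G: "graph_ok c V E" and G': "graph_ok c V' E'"
    and p: "realizes V E p" and p': "realizes V' E' p'"
    and eq: "rank_code V p = rank_code V' p'"
  shows "\<exists>f. graph_iso V E V' E' f"
proof -
  define vs where "vs = sorted_list_of_set V"
  define vs' where "vs' = sorted_list_of_set V'"
  have fin: "finite V" "finite V'" using G G' by (auto simp: graph_ok_def)
  define a where "a q X u = card {w\<in>X. q w \<le> q u}" for q :: "nat \<Rightarrow> real" and X u
  define b where "b q X u = card {w\<in>X. q w \<le> q u + 1}" for q :: "nat \<Rightarrow> real" and X u
  have eq': "map (a (fst \<circ> p) V) vs @ map (b (fst \<circ> p) V) vs @ map (a (snd \<circ> p) V) vs @ map (b (snd \<circ> p) V) vs =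
     map (a (fst \<circ> p') V') vs' @ map (b (fst \<circ> p') V') vs' @ map (a (snd \<circ> p') V') vs' @ map (b (snd \<circ> p') V') vs'"
    using eq by (simp add: rank_code_def Let_def vs_def vs'_def a_def [abs_def] b_def [abs_def] o_def)
  then have len: "length vs = length vs'" by (auto dest: arg_cong [of _ _ length])
  have m: "map (a (fst \<circ> p) V) vs = map (a (fst \<circ> p') V') vs'" "map (b (fst \<circ> p) V) vs = map (b (fst \<circ> p') V') vs'"
    "map (a (snd \<circ> p) V) vs = map (a (snd \<circ> p') V') vs'" "map (b (snd \<circ> p) V) vs = map (b (snd \<circ> p') V') vs'"
    using eq' len by simp_all
  have idx: "a (fst \<circ> p) V (vs ! i) = a (fst \<circ> p') V' (vs' ! i)" "b (fst \<circ> p) V (vs ! i) = b (fst \<circ> p') V' (vs' ! i)"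
    "a (snd \<circ> p) V (vs ! i) = a (snd \<circ> p') V' (vs' ! i)" "b (snd \<circ> p) V (vs ! i) = b (snd \<circ> p') V' (vs' ! i)"
    if "i < length vs" for i
    using m [THEN arg_cong, of "\<lambda>l. l ! i"] that len by simp_all
  have sets: "set vs = V" "set vs' = V'" "distinct vs" "distinct vs'" using fin by (auto simp: vs_def vs'_def)
  have ab: "a q X v \<le> b q X u \<longleftrightarrow> q v \<le> q u + 1" if "finite X" "v \<in> X" for q X u v
    unfolding a_def b_def using card_rank_le_iff [OF that] .
  have near: "E u v \<longleftrightarrow> u \<noteq> v \<and> a (fst \<circ> p) V v \<le> b (fst \<circ> p) V u \<and> a (fst \<circ> p) V u \<le> b (fst \<circ> p) V v \<and>
      a (snd \<circ> p) V v \<le> b (snd \<circ> p) V u \<and> a (snd \<circ> p) V u \<le> b (snd \<circ> p) V v"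
    if "u \<in> V" "v \<in> V" for u v
    using realizesD [OF p that] graph_ok_edge(4) [OF G] ab [OF fin(1)] that by (auto simp: abs_le_iff)
  have near': "E' u v \<longleftrightarrow> u \<noteq> v \<and> a (fst \<circ> p') V' v \<le> b (fst \<circ> p') V' u \<and> a (fst \<circ> p') V' u \<le> b (fst \<circ> p') V' v \<and>
      a (snd \<circ> p') V' v \<le> b (snd \<circ> p') V' u \<and> a (snd \<circ> p') V' u \<le> b (snd \<circ> p') V' v"
    if "u \<in> V'" "v \<in> V'" for u v
    using realizesD [OF p' that] graph_ok_edge(4) [OF G'] ab [OF fin(2)] that by (auto simp: abs_le_iff)
  show ?thesis
  proof (rule graph_iso_lists [OF sets(1,2) len])
    fix i j assume ij: "i < length vs" "j < length vs"
    show *: "vs ! i = vs ! j \<longleftrightarrow> vs' ! i = vs' ! j" using ij sets len by (simp add: nth_eq_iff_index_eq)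
    have "vs ! i \<in> V" "vs ! j \<in> V" "vs' ! i \<in> V'" "vs' ! j \<in> V'" using ij sets len by (metis nth_mem)+
    then show "E (vs ! i) (vs ! j) \<longleftrightarrow> E' (vs' ! i) (vs' ! j)"
      using * near near' idx ij by presburger
  qed
qed

lemma ex_pls_unit_square:
  assumes c: "c \<ge> 1"
  shows "\<exists>A P. pls_correct unit_square_graph c A P \<and>
    (\<forall>V E. graph_ok c V E \<longrightarrow> unit_square_graph V E \<longrightarrow>
       (\<forall>v\<in>V. length (P V E v) \<le> 2 * (4 * card V * (2 * length (bits (card V)) + 1))
          + 3 * c * length (bits (card V)) + 2))"
proof -
  define re where "re V E = (SOME p. realizes V E p)" for V E
  have re: "realizes V E (re V E)" if us: "unit_square_graph V E" for V E
  proof -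
    obtain p where "realizes V E p" using us unfolding unit_square_graph_iff_realizes by blast
    then show ?thesis unfolding re_def by (rule someI [of "realizes V E"])
  qed
  show ?thesis
  proof (rule pls_from_code [OF c, where enc = "\<lambda>V E. encode_nats (rank_code V (re V E))"
        and L = "\<lambda>n. 4 * n * (2 * length (bits n) + 1)"])
    show "unit_square_graph V E" if "unit_square_graph V' E'" "graph_iso V E V' E' f" for V E V' E' f
      using that unit_square_graph_iso by blast
    show "\<exists>f. graph_iso V E V' E' f" if "graph_ok c V E" "unit_square_graph V E" "graph_ok c V' E'"
        "unit_square_graph V' E'" "encode_nats (rank_code V (re V E)) = encode_nats (rank_code V' (re V' E'))"
      for V E V' E'
      using rank_code_iso [OF that(1,3) re [OF that(2)] re [OF that(4)] encode_nats_inject [OF that(5)]] .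
    show "length (encode_nats (rank_code V (re V E))) \<le> 4 * card V * (2 * length (bits (card V)) + 1)"
      if "graph_ok c V E" "unit_square_graph V E" for V E
    proof -
      have fin: "finite V" using that by (simp add: graph_ok_def)
      have "length (encode_nats (rank_code V (re V E))) \<le> length (rank_code V (re V E)) * (2 * length (bits (card V)) + 1)"
        by (rule length_encode_nats)
           (use fin in \<open>auto simp: rank_code_def Let_def intro!: length_bits_mono card_mono\<close>)
      also have "length (rank_code V (re V E)) = 4 * card V" using fin by (simp add: rank_code_def Let_def)
      finally show ?thesis .
    qed
  qed
qed

text \<open>Splicing \<open>u, v, u\<close> in for an occurrence of \<open>u\<close> adds the vertex \<open>v\<close> at the cost of two steps.\<close>

lemma covering_walk:
  assumes G: "graph_ok c V E"
  obtains ws where "length ws = 2 * card V - 1" "set ws = V" "successively E ws"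
proof -
  have fin: "finite V" "V \<noteq> {}" using G by (auto simp: graph_ok_def)
  have "\<exists>ws. length ws = 2 * k + 1 \<and> set ws \<subseteq> V \<and> card (set ws) = Suc k \<and> successively E ws"
    if "Suc k \<le> card V" for k
    using that
  proof (induction k)
    case 0
    obtain v where "v \<in> V" using fin by blast
    then show ?case by (intro exI [of _ "[v]"]) auto
  next
    case (Suc k)
    then obtain ws where ws: "length ws = 2 * k + 1" "set ws \<subseteq> V" "card (set ws) = Suc k" "successively E ws"
      by auto
    have ne: "set ws \<noteq> V" using Suc.prems ws by auto
    have "\<exists>u v. u \<in> set ws \<and> v \<notin> set ws \<and> E u v"
    proof (rule ccontr)
      assume no: "\<not> ?thesis"
      obtain a where a: "a \<in> set ws" using ws(1) by (cases ws) auto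
      have "b \<in> set ws" if "b \<in> V" for b
        by (rule graph_ok_connected_induct [OF G, of a "\<lambda>x. x \<in> set ws"]) (use a ws no that in auto)
      then show False using ne ws(2) by blast
    qed
    then obtain u v where uv: "u \<in> set ws" "v \<notin> set ws" "E u v" by blast
    then obtain xs ys where s: "ws = xs @ u # ys" by (meson split_list)
    have "E v u" "v \<in> V" using graph_ok_edge [OF G uv(3)] by auto
    then have "length (xs @ u # v # u # ys) = 2 * Suc k + 1" "set (xs @ u # v # u # ys) \<subseteq> V"
      "card (set (xs @ u # v # u # ys)) = Suc (Suc k)" "successively E (xs @ u # v # u # ys)"
      using ws s uv by (auto simp: successively_append_iff successively_Cons insert_commute [of u v] card_insert_if)
    then show ?case by blast
  qed
  from this [of "card V - 1"] obtain ws where "length ws = 2 * (card V - 1) + 1" "set ws \<subseteq> V"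
      "card (set ws) = Suc (card V - 1)" "successively E ws"
    using fin by (auto simp: Suc_le_eq card_gt_0_iff)
  moreover have "card V > 0" using fin by (simp add: card_gt_0_iff)
  moreover have "set ws = V"
    using fin calculation by (intro card_subset_eq) auto
  ultimately show ?thesis by (intro that [of ws]) auto
qed

text \<open>\<open>(x, y, s)\<close> locates a vertex in cell \<open>(x, y)\<close> of the unit grid; a triangle-free graph has at most
  two vertices per cell, which the Boolean \<open>s\<close> tells apart.\<close>

type_synonym site = "int \<times> int \<times> bool"

text \<open>Relative in the grid but absolute in the Boolean of the target: the values along a walk
  can be added up, and they do not depend on where the drawing lies.\<close>

definition rel_site :: "site \<Rightarrow> site \<Rightarrow> site" where
  "rel_site q q' = (fst q' - fst q, fst (snd q') - fst (snd q), snd (snd q'))"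

definition nearby :: "site set" where "nearby = {-1..1} \<times> {-1..1} \<times> UNIV"

definition placement :: "nat set \<Rightarrow> (nat \<Rightarrow> nat \<Rightarrow> bool) \<Rightarrow> (nat \<Rightarrow> site) \<Rightarrow> bool" where
  "placement V E q \<longleftrightarrow> inj_on q V \<and> (\<forall>u v. E u v \<longrightarrow> rel_site (q u) (q v) \<in> nearby)"

lemma ex_placement:
  assumes G: "graph_ok c V E" and tf: "triangle_free_unit_square_graph V E"
  shows "\<exists>q. placement V E q"
proof -
  obtain p where "realizes V E p"
    using tf unfolding triangle_free_unit_square_graph_def unit_square_graph_iff_realizes by blast
  note p = realizesD [OF this]
  define x where "x u = \<lfloor>fst (p u)\<rfloor>" for u
  define y where "y u = \<lfloor>snd (p u)\<rfloor>" for u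
  define s where "s u \<longleftrightarrow> (\<exists>w\<in>V. w < u \<and> x w = x u \<and> y w = y u)" for u
  have same_cell: "E u v" if "u \<in> V" "v \<in> V" "u \<noteq> v" "x u = x v" "y u = y v" for u v
  proof -
    have "\<bar>fst (p u) - fst (p v)\<bar> \<le> 1" "\<bar>snd (p u) - snd (p v)\<bar> \<le> 1"
      using that(4,5) unfolding x_def y_def by linarith+
    then show ?thesis using p that by blast
  qed
  have tri: "\<not> (E u v \<and> E v w \<and> E u w)" if "u \<in> V" "v \<in> V" "w \<in> V" for u v w
    using tf that unfolding triangle_free_unit_square_graph_def triangle_free_def by blast
  \<comment> \<open>If the Booleans agree, both are \<open>True\<close>, since \<open>v\<close> has
    the smaller \<open>u\<close> in its cell. The witness for \<open>u\<close> is then a third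
    vertex of the cell.\<close>
  have lt: "s u \<noteq> s v" if "u \<in> V" "v \<in> V" "u < v" "x u = x v" "y u = y v" for u v
  proof
    assume eq: "s u = s v"
    have "s v" using that unfolding s_def by auto
    then obtain w where w: "w \<in> V" "w < u" "x w = x u" "y w = y u" using eq unfolding s_def by auto
    show False using tri [of w u v] same_cell [of w u] same_cell [of u v] same_cell [of w v] w that by auto
  qed
  have "inj_on (\<lambda>u. (x u, y u, s u)) V"
  proof (rule inj_onI)
    fix u v assume "u \<in> V" "v \<in> V" "(x u, y u, s u) = (x v, y v, s v)"
    then show "u = v" using lt [of u v] lt [of v u] by (metis nat_neq_iff prod.inject)
  qed
  moreover have "rel_site (x u, y u, s u) (x v, y v, s v) \<in> nearby" if "E u v" for u v
  proof -
    have "\<bar>fst (p u) - fst (p v)\<bar> \<le> 1 \<and> \<bar>snd (p u) - snd (p v)\<bar> \<le> 1"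
      using p graph_ok_edge [OF G that] that by blast
    then have "\<bar>x v - x u\<bar> \<le> 1" "\<bar>y v - y u\<bar> \<le> 1" unfolding x_def y_def by linarith+
    then show ?thesis by (auto simp: rel_site_def nearby_def)
  qed
  ultimately show ?thesis unfolding placement_def by (intro exI [of _ "\<lambda>u. (x u, y u, s u)"]) auto
qed

text \<open>For \<open>k = 0\<close> the truncated predecessor is position 0 itself, so the first
  symbol records the Boolean of the start. All symbols come from the finite set
  \<open>nearby \<times> Pow nearby\<close>, hence a constant number of bits per step.\<close>

definition walk_symbol ::
  "(nat \<Rightarrow> nat \<Rightarrow> bool) \<Rightarrow> (nat \<Rightarrow> site) \<Rightarrow> nat list \<Rightarrow> nat \<Rightarrow> site \<times> site set" where
  "walk_symbol E q ws k = (rel_site (q (ws ! (k - 1))) (q (ws ! k)),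
     {rel_site (q (ws ! k)) (q u) | u. E (ws ! k) u})"

lemma rel_site_trans:
  "rel_site a b = rel_site a' b' \<Longrightarrow> rel_site b d = rel_site b' d' \<Longrightarrow> rel_site a d = rel_site a' d'"
  by (auto simp: rel_site_def)

lemma rel_site_cong:
  assumes "rel_site a b = rel_site a' b'" "rel_site a d = rel_site a' d'"
  shows "rel_site b d = rel_site b' d'"
  using assms by (auto simp: rel_site_def)

text \<open>Summing displacements recovers all sites relative to the start. As a placement is
  injective, equal sites are equal vertices, and the recorded neighbourhoods then give the
  edges.\<close>

lemma walk_symbol_iso:
  assumes G: "graph_ok c V E" and G': "graph_ok c V' E'"
    and q: "placement V E q" and q': "placement V' E' q'"
    and ws: "set ws = V" and ws': "set ws' = V'" and len: "length ws = length ws'"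
    and eq: "\<And>k. k < length ws \<Longrightarrow> walk_symbol E q ws k = walk_symbol E' q' ws' k"
  shows "\<exists>f. graph_iso V E V' E' f"
proof (rule graph_iso_lists [OF ws ws' len])
  have "rel_site (q (ws ! 0)) (q (ws ! k)) = rel_site (q' (ws' ! 0)) (q' (ws' ! k))" if "k < length ws" for k
    using that
  proof (induction k)
    case 0 then show ?case using eq [of 0] by (auto simp: walk_symbol_def)
  next
    case (Suc k)
    then show ?case using eq [of "Suc k"] by (auto simp: walk_symbol_def intro: rel_site_trans)
  qed
  then have rel: "rel_site (q (ws ! i)) (q (ws ! j)) = rel_site (q' (ws' ! i)) (q' (ws' ! j))"
    if "i < length ws" "j < length ws" for i j
    using that rel_site_cong by blast
  have slot: "snd (snd (q (ws ! i))) = snd (snd (q' (ws' ! i)))" if "i < length ws" for i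
    using rel [OF that that] by (simp add: rel_site_def)
  fix i j assume ij: "i < length ws" "j < length ws"
  have mem: "ws ! i \<in> V" "ws ! j \<in> V" "ws' ! i \<in> V'" "ws' ! j \<in> V'"
    using ij ws ws' len by (metis nth_mem)+
  have "q (ws ! i) = q (ws ! j) \<longleftrightarrow> q' (ws' ! i) = q' (ws' ! j)"
    using rel [OF ij] slot ij by (auto simp: rel_site_def prod_eq_iff)
  then show "ws ! i = ws ! j \<longleftrightarrow> ws' ! i = ws' ! j"
    using q q' mem by (auto simp: placement_def inj_on_eq_iff)
  have half: "E2 (ws2 ! i) (ws2 ! j)"
    if "E1 (ws1 ! i) (ws1 ! j)" "walk_symbol E1 q1 ws1 i = walk_symbol E2 q2 ws2 i"
      "rel_site (q1 (ws1 ! i)) (q1 (ws1 ! j)) = rel_site (q2 (ws2 ! i)) (q2 (ws2 ! j))"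
      "graph_ok c V2 E2" "inj_on q2 V2" "ws2 ! j \<in> V2" for E1 q1 ws1 E2 q2 ws2 V2
  proof -
    have "rel_site (q1 (ws1 ! i)) (q1 (ws1 ! j)) \<in> snd (walk_symbol E1 q1 ws1 i)"
      using that(1) by (auto simp: walk_symbol_def)
    then have "rel_site (q2 (ws2 ! i)) (q2 (ws2 ! j)) \<in> snd (walk_symbol E2 q2 ws2 i)"
      using that(2,3) by simp
    then obtain u where u: "E2 (ws2 ! i) u" "rel_site (q2 (ws2 ! i)) (q2 (ws2 ! j)) = rel_site (q2 (ws2 ! i)) (q2 u)"
      by (auto simp: walk_symbol_def)
    then have "q2 u = q2 (ws2 ! j)" by (auto simp: rel_site_def prod_eq_iff)
    then have "u = ws2 ! j" using that(5,6) graph_ok_edge(2) [OF that(4) u(1)] by (auto dest: inj_onD)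
    then show ?thesis using u by simp
  qed
  show "E (ws ! i) (ws ! j) \<longleftrightarrow> E' (ws' ! i) (ws' ! j)"
    using half [of E ws q E' q' ws' V'] half [of E' ws' q' E q ws V] eq [OF ij(1)] rel [OF ij] G G' q q' mem
    unfolding placement_def by metis
qed

lemma walk_symbol_in:
  assumes "graph_ok c V E" "placement V E q" "successively E ws" "k < length ws"
  shows "walk_symbol E q ws k \<in> nearby \<times> Pow nearby"
proof -
  have "rel_site (q (ws ! (k - 1))) (q (ws ! k)) \<in> nearby"
  proof (cases k)
    case 0 then show ?thesis by (simp add: rel_site_def nearby_def)
  next
    case (Suc l)
    then have "E (ws ! l) (ws ! k)" using assms(3,4) by (auto simp: successively_conv_nth)
    then show ?thesis using assms(2) Suc by (simp add: placement_def)
  qed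
  then show ?thesis using assms(2) by (auto simp: walk_symbol_def placement_def)
qed

lemma ex_pls_triangle_free_unit_square:
  assumes c: "c \<ge> 1"
  shows "\<exists>C. \<exists>A P. pls_correct triangle_free_unit_square_graph c A P \<and>
    (\<forall>V E. graph_ok c V E \<longrightarrow> triangle_free_unit_square_graph V E \<longrightarrow>
       (\<forall>v\<in>V. length (P V E v) \<le> 2 * (2 * card V * C) + 3 * c * length (bits (card V)) + 2))"
proof -
  have fin: "finite (nearby \<times> Pow nearby)" by (simp add: nearby_def)
  then obtain h :: "site \<times> site set \<Rightarrow> nat" where h: "bij_betw h (nearby \<times> Pow nearby) {0..<card (nearby \<times> Pow nearby)}"
    using ex_bij_betw_finite_nat by blast
  define B where "B = card (nearby \<times> Pow nearby)"
  have bd: "h z < B" if "z \<in> nearby \<times> Pow nearby" for z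
    using h that by (auto simp: bij_betw_def B_def)
  have inj: "inj_on h (nearby \<times> Pow nearby)" using h by (simp add: bij_betw_def)
  define ok where "ok V E = (\<lambda>(q, ws). placement V E q \<and> length ws = 2 * card V - 1 \<and> set ws = V \<and> successively E ws)"
    for V E
  define ch where "ch V E = (SOME d. ok V E d)" for V E
  have ch: "ok V E (ch V E)" if G: "graph_ok c V E" "triangle_free_unit_square_graph V E" for V E
  proof -
    obtain q where "placement V E q" using ex_placement [OF G] by blast
    moreover obtain ws where "length ws = 2 * card V - 1" "set ws = V" "successively E ws"
      using covering_walk [OF G(1)] by blast
    ultimately have "ok V E (q, ws)" by (simp add: ok_def)
    then show ?thesis unfolding ch_def by (rule someI)
  qed
  define co where "co V E = map (\<lambda>k. h (walk_symbol E (fst (ch V E)) (snd (ch V E)) k)) [0..<2 * card V - 1]" for V E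
  have "\<exists>A P. pls_correct triangle_free_unit_square_graph c A P \<and>
    (\<forall>V E. graph_ok c V E \<longrightarrow> triangle_free_unit_square_graph V E \<longrightarrow>
       (\<forall>v\<in>V. length (P V E v) \<le> 2 * (2 * card V * (2 * length (bits B) + 1)) + 3 * c * length (bits (card V)) + 2))"
  proof (rule pls_from_code [OF c, where enc = "\<lambda>V E. encode_nats (co V E)"
        and L = "\<lambda>n. 2 * n * (2 * length (bits B) + 1)"])
    show "triangle_free_unit_square_graph V E" if "triangle_free_unit_square_graph V' E'" "graph_iso V E V' E' f"
      for V E V' E' f
      using that triangle_free_unit_square_graph_iso by blast
    show "\<exists>f. graph_iso V E V' E' f" if G: "graph_ok c V E" "triangle_free_unit_square_graph V E"
        and G': "graph_ok c V' E'" "triangle_free_unit_square_graph V' E'"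
        and eq: "encode_nats (co V E) = encode_nats (co V' E')"
      for V E V' E'
    proof -
      obtain q ws where 1: "ch V E = (q, ws)" "placement V E q" "length ws = 2 * card V - 1" "set ws = V" "successively E ws"
        using ch [OF G] by (cases "ch V E") (auto simp: ok_def)
      obtain q' ws' where 2: "ch V' E' = (q', ws')" "placement V' E' q'" "length ws' = 2 * card V' - 1" "set ws' = V'" "successively E' ws'"
        using ch [OF G'] by (cases "ch V' E'") (auto simp: ok_def)
      have co: "co V E = map (\<lambda>k. h (walk_symbol E q ws k)) [0..<length ws]"
        "co V' E' = map (\<lambda>k. h (walk_symbol E' q' ws' k)) [0..<length ws']"
        using 1 2 by (simp_all add: co_def)
      have eq: "co V E = co V' E'" using encode_nats_inject [OF eq] .
      have len: "length ws = length ws'" using arg_cong [OF eq, of length] co by simp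
      have "walk_symbol E q ws k = walk_symbol E' q' ws' k" if k: "k < length ws" for k
      proof -
        have "h (walk_symbol E q ws k) = h (walk_symbol E' q' ws' k)"
          using arg_cong [OF eq, of "\<lambda>l. l ! k"] co len k by simp
        then show ?thesis
          using inj_onD [OF inj] walk_symbol_in [OF G(1) 1(2,5) k] walk_symbol_in [OF G'(1) 2(2,5)] k len by simp
      qed
      then show ?thesis using walk_symbol_iso [OF G(1) G'(1) 1(2) 2(2) 1(4) 2(4) len] by blast
    qed
    show "length (encode_nats (co V E)) \<le> 2 * card V * (2 * length (bits B) + 1)"
      if G: "graph_ok c V E" "triangle_free_unit_square_graph V E" for V E
    proof -
      obtain q ws where 1: "ch V E = (q, ws)" "placement V E q" "length ws = 2 * card V - 1" "set ws = V" "successively E ws"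
        using ch [OF G] by (cases "ch V E") (auto simp: ok_def)
      have "length (encode_nats (co V E)) \<le> length (co V E) * (2 * length (bits B) + 1)"
      proof (rule length_encode_nats)
        fix a assume "a \<in> set (co V E)"
        then obtain k where "k < length ws" "a = h (walk_symbol E q ws k)" using 1 by (auto simp: co_def)
        then have "a < B" using bd walk_symbol_in [OF G(1) 1(2,5)] by auto
        then show "length (bits a) \<le> length (bits B)" by (intro length_bits_mono) simp
      qed
      also have "\<dots> \<le> 2 * card V * (2 * length (bits B) + 1)" by (intro mult_right_mono) (auto simp: co_def)
      finally show ?thesis .
    qed
  qed
  then show ?thesis by blast
qed

section \<open>Bounds on the local complexity\<close>

lemma local_complexity_le:
  assumes "pls_correct cls c A P"
    and "\<And>V E v. graph_ok c V E \<Longrightarrow> card V = n \<Longrightarrow> cls V E \<Longrightarrow> v \<in> V \<Longrightarrow> length (P V E v) \<le> s"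
  shows "local_complexity cls c n \<le> s"
  unfolding local_complexity_def by (rule Least_le) (use assms in blast)

text \<open>\<open>LEAST\<close> has its meaning only if some scheme with bounded certificates
  exists. This is why the lower bounds start from the schemes constructed above.\<close>

lemma local_complexity_attained:
  assumes "pls_correct cls c A P"
    and "\<And>V E v. graph_ok c V E \<Longrightarrow> card V = n \<Longrightarrow> cls V E \<Longrightarrow> v \<in> V \<Longrightarrow> length (P V E v) \<le> s"
  shows "\<exists>A P. pls_correct cls c A P \<and>
        (\<forall>V E. graph_ok c V E \<longrightarrow> card V = n \<longrightarrow> cls V E \<longrightarrow>
           (\<forall>v\<in>V. length (P V E v) \<le> local_complexity cls c n))"
  unfolding local_complexity_def by (rule LeastI [of _ s]) (use assms in blast)

lemma triangle_free_upper:
  assumes c: "c \<ge> 1"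
  shows "(\<lambda>n. real (local_complexity triangle_free_unit_square_graph c n)) \<in> O(\<lambda>n. real n)"
proof -
  obtain C A P where *: "pls_correct triangle_free_unit_square_graph c A P"
    "\<forall>V E. graph_ok c V E \<longrightarrow> triangle_free_unit_square_graph V E \<longrightarrow>
       (\<forall>v\<in>V. length (P V E v) \<le> 2 * (2 * card V * C) + 3 * c * length (bits (card V)) + 2)"
    using ex_pls_triangle_free_unit_square [OF c] by blast
  have "real (local_complexity triangle_free_unit_square_graph c n) \<le> real (4 * C + 3 * c + 2) * real n"
    if "n \<ge> 1" for n
  proof -
    have "local_complexity triangle_free_unit_square_graph c n \<le> 2 * (2 * n * C) + 3 * c * length (bits n) + 2"
      by (rule local_complexity_le [OF *(1)]) (use *(2) in blast)
    also have "\<dots> \<le> 2 * (2 * n * C) + 3 * c * n + 2 * n"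
      using length_bits_le_self [of n] that by (intro add_mono mult_left_mono) auto
    also have "\<dots> = (4 * C + 3 * c + 2) * n" by (simp add: algebra_simps)
    finally show ?thesis by (metis of_nat_le_iff of_nat_mult)
  qed
  then show ?thesis
    by (intro bigoI [of _ "real (4 * C + 3 * c + 2)"] eventually_mono [OF eventually_ge_at_top [of 1]]) auto
qed

lemma ln_2_ge_half: "1 / 2 \<le> ln (2 :: real)"
  using ln_one_minus_pos_upper_bound [of "1 / 2 :: real"] by (simp add: ln_div)

text \<open>Since \<open>ln 2 \<ge> 1 / 2\<close>, the binary logarithm is at most
  \<open>2 * ln n\<close>; the one additional bit is absorbed by
  \<open>1 \<le> ln n\<close>.\<close>

lemma length_bits_le_ln:
  assumes "n \<ge> 3"
  shows "real (length (bits n)) \<le> 3 * ln (real n)" and "1 \<le> ln (real n)"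
proof -
  define b where "b = length (bits n)"
  have "exp 1 \<le> real n" using exp_le assms by linarith
  then show 1: "1 \<le> ln (real n)" using assms by (simp add: ln_ge_iff)
  have b: "b \<ge> 1" using less_two_power_length_bits [of n] assms by (cases b) (auto simp: b_def)
  have "\<not> n < 2 ^ (b - 1)" using length_bits_le [of n "b - 1"] b by (auto simp: b_def)
  then have "(2::real) ^ (b - 1) \<le> real n"
    by (metis not_less of_nat_le_iff of_nat_numeral of_nat_power)
  then have "ln ((2::real) ^ (b - 1)) \<le> ln (real n)" using assms by (intro ln_mono) auto
  then have "real (b - 1) * ln 2 \<le> ln (real n)" by (simp add: ln_realpow)
  moreover have "real (b - 1) * (1 / 2) \<le> real (b - 1) * ln 2"
    using ln_2_ge_half by (intro mult_left_mono) auto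
  ultimately have "real b \<le> 1 + 2 * ln (real n)" using b by (simp add: of_nat_diff)
  then show "real (length (bits n)) \<le> 3 * ln (real n)" using 1 by (simp add: b_def)
qed

lemma unit_square_upper:
  assumes c: "c \<ge> 1"
  shows "(\<lambda>n. real (local_complexity unit_square_graph c n)) \<in> O(\<lambda>n. real n * ln (real n))"
proof -
  obtain A P where *: "pls_correct unit_square_graph c A P"
    "\<forall>V E. graph_ok c V E \<longrightarrow> unit_square_graph V E \<longrightarrow>
       (\<forall>v\<in>V. length (P V E v) \<le> 2 * (4 * card V * (2 * length (bits (card V)) + 1)) + 3 * c * length (bits (card V)) + 2)"
    using ex_pls_unit_square [OF c] by blast
  have "real (local_complexity unit_square_graph c n) \<le> (58 + 9 * real c) * (real n * ln (real n))"
    if n: "n \<ge> 3" for n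
  proof -
    define l where "l = ln (real n)"
    have l: "1 \<le> l" "real (length (bits n)) \<le> 3 * l" using length_bits_le_ln [OF n] by (auto simp: l_def)
    have "local_complexity unit_square_graph c n \<le> 2 * (4 * n * (2 * length (bits n) + 1)) + 3 * c * length (bits n) + 2"
      by (rule local_complexity_le [OF *(1)]) (use *(2) in blast)
    then have "real (local_complexity unit_square_graph c n) \<le>
        real (2 * (4 * n * (2 * length (bits n) + 1)) + 3 * c * length (bits n) + 2)"
      using of_nat_le_iff by blast
    also have "\<dots> = 8 * real n * (2 * real (length (bits n)) + 1) + 3 * real c * real (length (bits n)) + 2"
      by (simp add: algebra_simps)
    also have "\<dots> \<le> 8 * real n * (7 * l) + 3 * real c * (3 * l) + 2"
      using l by (intro add_mono mult_left_mono) auto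
    also have "\<dots> \<le> 8 * real n * (7 * l) + 3 * real c * (3 * (real n * l)) + 2 * (real n * l)"
    proof -
      have "1 * l \<le> real n * l" using n l by (intro mult_right_mono) auto
      moreover have "1 \<le> real n * l" using calculation l by linarith
      ultimately show ?thesis by (intro add_mono mult_left_mono) auto
    qed
    also have "\<dots> = (58 + 9 * real c) * (real n * l)" by (simp add: algebra_simps)
    finally show ?thesis by (simp add: l_def)
  qed
  then show ?thesis
    by (intro bigoI [of _ "58 + 9 * real c"] eventually_mono [OF eventually_ge_at_top [of 3]]) auto
qed

section \<open>Fooling sets\<close>

lemma card_bool_lists_le: "finite {l :: bool list. length l \<le> s}" "card {l :: bool list. length l \<le> s} < 2 ^ (s + 1)"
proof -
  have *: "{l :: bool list. length l \<le> s} = {l. set l \<subseteq> UNIV \<and> length l \<le> s}" by simp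
  show "finite {l :: bool list. length l \<le> s}" unfolding * by (rule finite_lists_length_le) simp
  show "card {l :: bool list. length l \<le> s} < 2 ^ (s + 1)"
  proof -
    have "(\<Sum>i\<le>s. 2 ^ i) < (2 :: nat) ^ (s + 1)" by (induction s) auto
    then show ?thesis unfolding * by (subst card_lists_length_le) auto
  qed
qed

text \<open>If \<open>EG x x\<close> and \<open>EG y y\<close> received the same certificates on the boundary \<open>D\<close>, gluing the
  certificates of \<open>EG x x\<close> on the side \<open>S\<close> to those of \<open>EG y y\<close> on the other side would make every vertex
  of \<open>EG x y\<close> accept.\<close>

lemma fooling_set_bound:
  assumes pls: "pls_correct cls c A P"
    and ok: "\<And>x y. x \<in> X \<Longrightarrow> y \<in> X \<Longrightarrow> graph_ok c V (EG x y)"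
    and yes: "\<And>x. x \<in> X \<Longrightarrow> cls V (EG x x)"
    and no: "\<And>x y. x \<in> X \<Longrightarrow> y \<in> X \<Longrightarrow> x \<noteq> y \<Longrightarrow> \<not> cls V (EG x y)"
    and left: "\<And>x y u v. u \<in> S \<Longrightarrow> EG x y u v = EG x x u v"
    and right: "\<And>x y u v. u \<notin> S \<Longrightarrow> EG x y u v = EG y y u v"
    and cut: "\<And>x y u v. u \<in> S \<Longrightarrow> v \<notin> S \<Longrightarrow> EG x y u v \<or> EG x y v u \<Longrightarrow> u \<in> D \<and> v \<in> D"
    and D: "finite D" "D \<subseteq> V" 
    and len: "\<And>x v. x \<in> X \<Longrightarrow> v \<in> V \<Longrightarrow> length (P V (EG x x) v) \<le> s"
  shows "card X \<le> 2 ^ ((s + 1) * card D)"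
proof -
  define L where "L = {l :: bool list. length l \<le> s}"
  define R where "R x = restrict (P V (EG x x)) D" for x
  have "inj_on R X"
  proof (rule inj_onI, rule ccontr)
    fix x y assume xy: "x \<in> X" "y \<in> X" "R x = R y" "x \<noteq> y"
    have agree: "P V (EG x x) u = P V (EG y y) u" if "u \<in> D" for u
      using fun_cong [OF xy(3), of u] that by (simp add: R_def)
    define ce where "ce u = (if u \<in> S then P V (EG x x) u else P V (EG y y) u)" for u
    obtain v where v: "v \<in> V" "\<not> A v (view V (EG x y) ce v)"
      using pls ok [OF xy(1,2)] no [OF xy(1,2,4)] unfolding pls_correct_def by blast
    have "view V (EG x y) ce v = view V (EG x x) (P V (EG x x)) v" if "v \<in> S"
    proof
      fix u show "view V (EG x y) ce v u = view V (EG x x) (P V (EG x x)) v u"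
        using left [OF that, of x y u] cut [OF that, of u x y] agree [of u] that by (auto simp: view_def ce_def)
    qed
    moreover have "view V (EG x y) ce v = view V (EG y y) (P V (EG y y)) v" if "v \<notin> S"
    proof
      fix u show "view V (EG x y) ce v u = view V (EG y y) (P V (EG y y)) v u"
        using right [OF that, of x y u] cut [OF _ that, of u x y] agree [of u] that by (auto simp: view_def ce_def)
    qed
    moreover have "A v (view V (EG z z) (P V (EG z z)) v)" if "z \<in> X" for z
      using pls ok [OF that that] yes [OF that] v(1) unfolding pls_correct_def by blast
    ultimately show False using v(2) xy(1,2) by (cases "v \<in> S") auto
  qed
  moreover have "R ` X \<subseteq> D \<rightarrow>\<^sub>E L" using len D(2) by (auto simp: R_def L_def)
  moreover have fin: "finite (D \<rightarrow>\<^sub>E L)" using D card_bool_lists_le(1) by (auto simp: L_def intro: finite_PiE)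
  ultimately have "card X \<le> card (D \<rightarrow>\<^sub>E L)" by (metis card_image card_mono)
  also have "\<dots> = card L ^ card D" using D by (simp add: card_PiE)
  also have "\<dots> \<le> (2 ^ (s + 1)) ^ card D"
    using card_bool_lists_le(2) [of s] by (intro power_mono) (auto simp: L_def)
  also have "\<dots> = 2 ^ ((s + 1) * card D)" by (rule power_mult [symmetric])
  finally show ?thesis .
qed

section \<open>Orientation of ladders\<close>

definition near :: "('a \<Rightarrow> real) \<Rightarrow> ('a \<Rightarrow> real) \<Rightarrow> 'a \<Rightarrow> 'a \<Rightarrow> bool" where
  "near X Y u v \<longleftrightarrow> \<bar>X u - X v\<bar> \<le> 1 \<and> \<bar>Y u - Y v\<bar> \<le> 1"

text \<open>A 4-cycle \<open>a, b, c, d\<close> with corners to the south, east, north and west.\<close>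

definition tilted :: "('a \<Rightarrow> real) \<Rightarrow> ('a \<Rightarrow> real) \<Rightarrow> 'a \<Rightarrow> 'a \<Rightarrow> 'a \<Rightarrow> 'a \<Rightarrow> bool" where
  "tilted X Y a b c d \<longleftrightarrow> Y a + 1 < Y c \<and> X d + 1 < X b"

lemma near_commute: "near X Y u v \<longleftrightarrow> near X Y v u"
  by (auto simp: near_def abs_minus_commute)

text \<open>A diagonal that is longer than 1 in one coordinate is bridged by two edges of length at
  most 1, so both edges go strictly the same way in that coordinate.\<close>

lemma tilted_order:
  assumes "tilted X Y a b c d" "near X Y a b" "near X Y b c" "near X Y c d" "near X Y a d"
  shows "X a < X b" "Y a < Y b" "X d < X c" "Y d < Y c" "X d < X a" "Y a < Y d" "X c < X b" "Y b < Y c"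
  using assms unfolding tilted_def near_def by linarith+

text \<open>The new cell shares the edge \<open>b c\<close>. Its two non-adjacent diagonals leave
  only the continued orientation or the one folded back over the old cell; folding back would bring
  \<open>b'\<close> near \<open>a\<close>.\<close>

lemma tilted_right:
  assumes "tilted X Y a b c d" "near X Y a b" "near X Y b c" "near X Y c d" "near X Y a d"
    "near X Y b b'" "near X Y c c'" "near X Y b' c'"
    "\<not> near X Y b c'" "\<not> near X Y b' c" "\<not> near X Y a b'"
  shows "tilted X Y b b' c' c"
proof -
  note o = tilted_order [OF assms(1-5)]
  show ?thesis using assms o unfolding tilted_def near_def by (smt (verit))
qed

lemma tilted_up:
  assumes "tilted X Y a b c d" "near X Y a b" "near X Y b c" "near X Y c d" "near X Y a d"
    "near X Y d d'" "near X Y c c'" "near X Y d' c'"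
    "\<not> near X Y d c'" "\<not> near X Y d' c" "\<not> near X Y a d'"
  shows "tilted X Y d c c' d'"
proof -
  note o = tilted_order [OF assms(1-5)]
  show ?thesis using assms o unfolding tilted_def near_def by (smt (verit))
qed

lemma tilted_down:
  assumes "tilted X Y a b c d" "near X Y a b" "near X Y b c" "near X Y c d" "near X Y a d"
    "near X Y a a'" "near X Y b b'" "near X Y a' b'"
    "\<not> near X Y a b'" "\<not> near X Y a' b" "\<not> near X Y d a'"
  shows "tilted X Y a' b' b a"
proof -
  note o = tilted_order [OF assms(1-5)]
  show ?thesis using assms o unfolding tilted_def near_def by (smt (verit))
qed

text \<open>The diagonals of an induced 4-cycle are separated in different coordinates, so a rotation or
  reflection of the plane tilts it.\<close>

lemma ex_tilted:
  assumes "near X Y a b" "near X Y b c" "near X Y c d" "near X Y a d" "\<not> near X Y a c" "\<not> near X Y b d"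
  obtains X' Y' where "tilted X' Y' a b c d" "near X' Y' = near X Y"
proof -
  have nx: "near (\<lambda>u. - X u) Y = near X Y" "near X (\<lambda>u. - Y u) = near X Y" "near Y X = near X Y" for X Y
    by (auto simp: near_def fun_eq_iff abs_minus_commute)
  have sep: "\<bar>X a - X c\<bar> > 1 \<and> \<bar>Y b - Y d\<bar> > 1 \<or> \<bar>Y a - Y c\<bar> > 1 \<and> \<bar>X b - X d\<bar> > 1"
    using assms unfolding near_def by (smt (verit))
  have "\<exists>X' Y'. tilted X' Y' a b c d \<and> near X' Y' = near X Y"
    if "\<bar>Y a - Y c\<bar> > 1" "\<bar>X b - X d\<bar> > 1" for X Y
  proof -
    have "tilted X Y a b c d \<or> tilted (\<lambda>u. - X u) Y a b c d \<or> tilted X (\<lambda>u. - Y u) a b c d \<or>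
        tilted (\<lambda>u. - X u) (\<lambda>u. - Y u) a b c d"
      using that unfolding tilted_def by linarith
    then show ?thesis using nx by metis
  qed
  from this [of X Y] this [of Y X] sep nx(3) [of X Y] show ?thesis using that by metis
qed

text \<open>The last clause, for the rail \<open>g\<close> only, is the non-adjacency that forbids
  folding back in \<open>tilted_right\<close>, \<open>tilted_up\<close> and
  \<open>tilted_down\<close>.\<close>

definition ladder :: "('a \<Rightarrow> real) \<Rightarrow> ('a \<Rightarrow> real) \<Rightarrow> (nat \<Rightarrow> 'a) \<Rightarrow> (nat \<Rightarrow> 'a) \<Rightarrow> nat \<Rightarrow> bool" where
  "ladder X Y g h L \<longleftrightarrow>
     (\<forall>k<L. near X Y (g k) (g (Suc k)) \<and> near X Y (h k) (h (Suc k)) \<and>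
        \<not> near X Y (g k) (h (Suc k)) \<and> \<not> near X Y (g (Suc k)) (h k)) \<and>
     (\<forall>k\<le>L. near X Y (g k) (h k)) \<and>
     (\<forall>k. Suc (Suc k) \<le> L \<longrightarrow> \<not> near X Y (g k) (g (Suc (Suc k))))"

lemma ladder_right:
  assumes l: "ladder X Y g h L" and t: "tilted X Y (g 0) (g 1) (h 1) (h 0)" and "k < L"
  shows "tilted X Y (g k) (g (Suc k)) (h (Suc k)) (h k)"
  using \<open>k < L\<close>
proof (induction k)
  case 0 then show ?case using t by simp
next
  case (Suc k)
  have k: "k < L" using Suc.prems by simp
  have n: "near X Y (g k) (g (Suc k))" "near X Y (g (Suc k)) (h (Suc k))" "near X Y (h (Suc k)) (h k)"
      "near X Y (g k) (h k)" "near X Y (g (Suc k)) (g (Suc (Suc k)))" "near X Y (h (Suc k)) (h (Suc (Suc k)))"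
      "near X Y (g (Suc (Suc k))) (h (Suc (Suc k)))" "\<not> near X Y (g (Suc k)) (h (Suc (Suc k)))"
      "\<not> near X Y (g (Suc (Suc k))) (h (Suc k))" "\<not> near X Y (g k) (g (Suc (Suc k)))"
    using l k Suc.prems by (auto simp: ladder_def near_commute [of X Y "h (Suc k)" "h k"])
  show ?case by (rule tilted_right [OF Suc.IH [OF k] n])
qed

lemma ladder_up:
  assumes l: "ladder X Y g h L" and t: "tilted X Y (g 0) (h 0) (h 1) (g 1)" and "k < L"
  shows "tilted X Y (g k) (h k) (h (Suc k)) (g (Suc k))"
  using \<open>k < L\<close>
proof (induction k)
  case 0 then show ?case using t by simp
next
  case (Suc k)
  have k: "k < L" using Suc.prems by simp
  have n: "near X Y (g k) (h k)" "near X Y (h k) (h (Suc k))" "near X Y (h (Suc k)) (g (Suc k))"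
      "near X Y (g k) (g (Suc k))" "near X Y (g (Suc k)) (g (Suc (Suc k)))" "near X Y (h (Suc k)) (h (Suc (Suc k)))"
      "near X Y (g (Suc (Suc k))) (h (Suc (Suc k)))" "\<not> near X Y (g (Suc k)) (h (Suc (Suc k)))"
      "\<not> near X Y (g (Suc (Suc k))) (h (Suc k))" "\<not> near X Y (g k) (g (Suc (Suc k)))"
    using l k Suc.prems by (auto simp: ladder_def near_commute [of X Y "h (Suc k)" "g (Suc k)"])
  show ?case by (rule tilted_up [OF Suc.IH [OF k] n])
qed

lemma ladder_down:
  assumes l: "ladder X Y g h L" and t: "tilted X Y (g 1) (h 1) (h 0) (g 0)" and "k < L"
  shows "tilted X Y (g (Suc k)) (h (Suc k)) (h k) (g k)"
  using \<open>k < L\<close>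
proof (induction k)
  case 0 then show ?case using t by simp
next
  case (Suc k)
  have k: "k < L" using Suc.prems by simp
  have n: "near X Y (g (Suc k)) (h (Suc k))" "near X Y (h (Suc k)) (h k)" "near X Y (h k) (g k)"
      "near X Y (g (Suc k)) (g k)" "near X Y (g (Suc k)) (g (Suc (Suc k)))" "near X Y (h (Suc k)) (h (Suc (Suc k)))"
      "near X Y (g (Suc (Suc k))) (h (Suc (Suc k)))" "\<not> near X Y (g (Suc k)) (h (Suc (Suc k)))"
      "\<not> near X Y (g (Suc (Suc k))) (h (Suc k))" "\<not> near X Y (g k) (g (Suc (Suc k)))"
    using l k Suc.prems
    by (auto simp: ladder_def near_commute [of X Y "h (Suc k)" "h k"] near_commute [of X Y "h k" "g k"]
      near_commute [of X Y "g (Suc k)" "g k"])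
  show ?case by (rule tilted_down [OF Suc.IH [OF k] n])
qed

lemma ladder_right_order:
  assumes l: "ladder X Y g h L" and t: "tilted X Y (g 0) (g 1) (h 1) (h 0)" and k: "k < L"
  shows "X (g k) < X (g (Suc k))" "X (g (Suc k)) \<le> X (g k) + 1" "Y (g k) < Y (g (Suc k))" "Y (g (Suc k)) \<le> Y (g k) + 1"
    "X (h k) < X (h (Suc k))" "X (h (Suc k)) \<le> X (h k) + 1" "Y (h k) < Y (h (Suc k))" "Y (h (Suc k)) \<le> Y (h k) + 1"
proof -
  have n: "near X Y (g k) (g (Suc k))" "near X Y (g (Suc k)) (h (Suc k))" "near X Y (h (Suc k)) (h k)" "near X Y (g k) (h k)"
    using l k by (auto simp: ladder_def near_commute [of X Y "h (Suc k)" "h k"])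
  show "X (g k) < X (g (Suc k))" "X (g (Suc k)) \<le> X (g k) + 1" "Y (g k) < Y (g (Suc k))" "Y (g (Suc k)) \<le> Y (g k) + 1"
    "X (h k) < X (h (Suc k))" "X (h (Suc k)) \<le> X (h k) + 1" "Y (h k) < Y (h (Suc k))" "Y (h (Suc k)) \<le> Y (h k) + 1"
    using tilted_order [OF ladder_right [OF assms] n] n unfolding near_def by linarith+
qed

lemma ladder_up_order:
  assumes l: "ladder X Y g h L" and t: "tilted X Y (g 0) (h 0) (h 1) (g 1)" and k: "k < L"
  shows "X (g (Suc k)) < X (g k)" "X (g k) \<le> X (g (Suc k)) + 1" "Y (g k) < Y (g (Suc k))" "Y (g (Suc k)) \<le> Y (g k) + 1"
    "X (h (Suc k)) < X (h k)" "X (h k) \<le> X (h (Suc k)) + 1" "Y (h k) < Y (h (Suc k))" "Y (h (Suc k)) \<le> Y (h k) + 1"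
proof -
  have n: "near X Y (g k) (h k)" "near X Y (h k) (h (Suc k))" "near X Y (h (Suc k)) (g (Suc k))" "near X Y (g k) (g (Suc k))"
    using l k by (auto simp: ladder_def near_commute [of X Y "h (Suc k)" "g (Suc k)"])
  show "X (g (Suc k)) < X (g k)" "X (g k) \<le> X (g (Suc k)) + 1" "Y (g k) < Y (g (Suc k))" "Y (g (Suc k)) \<le> Y (g k) + 1"
    "X (h (Suc k)) < X (h k)" "X (h k) \<le> X (h (Suc k)) + 1" "Y (h k) < Y (h (Suc k))" "Y (h (Suc k)) \<le> Y (h k) + 1"
    using tilted_order [OF ladder_up [OF assms] n] n unfolding near_def by linarith+
qed

lemma ladder_down_order:
  assumes l: "ladder X Y g h L" and t: "tilted X Y (g 1) (h 1) (h 0) (g 0)" and k: "k < L"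
  shows "X (g k) < X (g (Suc k))" "X (g (Suc k)) \<le> X (g k) + 1" "Y (g (Suc k)) < Y (g k)" "Y (g k) \<le> Y (g (Suc k)) + 1"
    "X (h k) < X (h (Suc k))" "X (h (Suc k)) \<le> X (h k) + 1" "Y (h (Suc k)) < Y (h k)" "Y (h k) \<le> Y (h (Suc k)) + 1"
    "X (g (Suc k)) < X (h (Suc k))" "Y (g (Suc k)) < Y (h (Suc k))"
proof -
  have n: "near X Y (g (Suc k)) (h (Suc k))" "near X Y (h (Suc k)) (h k)" "near X Y (h k) (g k)" "near X Y (g (Suc k)) (g k)"
    using l k
    by (auto simp: ladder_def near_commute [of X Y "h (Suc k)" "h k"] near_commute [of X Y "h k" "g k"]
      near_commute [of X Y "g (Suc k)" "g k"])
  show "X (g k) < X (g (Suc k))" "X (g (Suc k)) \<le> X (g k) + 1" "Y (g (Suc k)) < Y (g k)" "Y (g k) \<le> Y (g (Suc k)) + 1"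
    "X (h k) < X (h (Suc k))" "X (h (Suc k)) \<le> X (h k) + 1" "Y (h (Suc k)) < Y (h k)" "Y (h k) \<le> Y (h (Suc k)) + 1"
    "X (g (Suc k)) < X (h (Suc k))" "Y (g (Suc k)) < Y (h (Suc k))"
    using tilted_order [OF ladder_down [OF assms] n] n unfolding near_def by linarith+
qed

section \<open>Slow sequences and staircases\<close>

lemma slow_mono:
  fixes s :: "nat \<Rightarrow> real"
  assumes "\<And>k. k < L \<Longrightarrow> s k < s (Suc k)" "\<And>k. k < L \<Longrightarrow> s (Suc k) \<le> s k + 1" "i \<le> j" "j \<le> L"
  shows "s i \<le> s j" "s j \<le> s i + (real j - real i)"
  using assms(3,4)
proof (induction j rule: dec_induct)
  case base case 1 show ?case by simp
  case base case 2 show ?case by simp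
next
  case (step k) case 1 then show ?case using step assms(1) [of k] by simp
  case (step k) case 2 then show ?case using step assms(2) [of k] by simp
qed

lemma slow_antimono:
  fixes s :: "nat \<Rightarrow> real"
  assumes "\<And>k. k < L \<Longrightarrow> s (Suc k) < s k" "\<And>k. k < L \<Longrightarrow> s k \<le> s (Suc k) + 1" "i \<le> j" "j \<le> L"
  shows "s j \<le> s i" "s i \<le> s j + (real j - real i)"
proof -
  have *: "- s (Suc k) \<le> - s k + 1" if "k < L" for k using assms(2) [OF that] by simp
  show "s j \<le> s i" "s i \<le> s j + (real j - real i)"
    using slow_mono [of L "\<lambda>k. - s k" i j, OF _ *] assms(1,3,4) by simp_all
qed

lemma two_step_growth:
  fixes s :: "nat \<Rightarrow> real"
  assumes "\<And>k. Suc (Suc k) \<le> L \<Longrightarrow> s k + 1 < s (Suc (Suc k))" "a + 2 * j \<le> L"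
  shows "s a + j \<le> s (a + 2 * j)"
  using assms(2)
proof (induction j)
  case 0 then show ?case by simp
next
  case (Suc j) then show ?case using assms(1) [of "a + 2 * j"] by simp
qed

definition staircase :: "('a \<Rightarrow> real) \<Rightarrow> ('a \<Rightarrow> real) \<Rightarrow> (nat \<Rightarrow> 'a) \<Rightarrow> nat \<Rightarrow> bool" where
  "staircase X Y p L \<longleftrightarrow> (\<forall>k<L. X (p k) \<le> X (p (Suc k)) \<and> X (p (Suc k)) \<le> X (p k) + 1 \<and>
     Y (p k) \<le> Y (p (Suc k)) \<and> Y (p (Suc k)) \<le> Y (p k) + 1)"

text \<open>The north-west side of the staircase thickened by unit squares. The pointwise form
  replaces arguments about curves in the plane.\<close>

definition above :: "('a \<Rightarrow> real) \<Rightarrow> ('a \<Rightarrow> real) \<Rightarrow> (nat \<Rightarrow> 'a) \<Rightarrow> nat \<Rightarrow> 'a \<Rightarrow> bool" where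
  "above X Y p L z \<longleftrightarrow> (\<forall>k\<le>L. X z < X (p k) - 1 \<or> Y (p k) + 1 < Y z)"

text \<open>A point more than 1 to the left stays so, because \<open>X\<close> increases along the
  staircase. A point more than 1 above cannot be overtaken in height by one step, so without being
  near it remains above or has fallen behind to the left.\<close>

lemma above_start:
  assumes s: "staircase X Y p L" and z: "X z \<le> X (p 0)" "Y (p 0) \<le> Y z" and n: "\<And>k. k \<le> L \<Longrightarrow> \<not> near X Y (p k) z"
  shows "above X Y p L z"
  unfolding above_def
proof (intro allI impI)
  fix k assume "k \<le> L"
  then have "X z \<le> X (p k) \<and> (X z < X (p k) - 1 \<or> Y (p k) + 1 < Y z)"
  proof (induction k)
    case 0 then show ?case using z n [of 0] unfolding near_def by (smt (verit))
  next
    case (Suc k)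
    then have "X z \<le> X (p k) \<and> (X z < X (p k) - 1 \<or> Y (p k) + 1 < Y z)" by simp
    moreover have "X (p k) \<le> X (p (Suc k)) \<and> Y (p (Suc k)) \<le> Y (p k) + 1"
      using s Suc.prems unfolding staircase_def by simp
    ultimately show ?case using n [OF Suc.prems] unfolding near_def by (smt (verit))
  qed
  then show "X z < X (p k) - 1 \<or> Y (p k) + 1 < Y z" by simp
qed

text \<open>A walk that avoids the neighbourhoods of a staircase can only pass to its other side
  around one of the two ends.\<close>

lemma above_step:
  assumes s: "staircase X Y p L" and a: "above X Y p L z" and z: "near X Y z z'"
    and n: "\<And>k. k \<le> L \<Longrightarrow> \<not> near X Y (p k) z'"
    and e: "Y (p 0) - 1 \<le> Y z'" "X z' \<le> X (p L) + 1"
  shows "above X Y p L z'"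
proof (rule ccontr)
  assume "\<not> ?thesis"
  then obtain k where k: "k \<le> L" "\<not> (X z' < X (p k) - 1 \<or> Y (p k) + 1 < Y z')"
    by (auto simp: above_def)
  have zz: "\<bar>X z - X z'\<bar> \<le> 1" "\<bar>Y z - Y z'\<bar> \<le> 1" using z by (auto simp: near_def)
  have ab: "X z < X (p j) - 1 \<or> Y (p j) + 1 < Y z" if "j \<le> L" for j using a that by (simp add: above_def)
  have st: "X (p j) \<le> X (p (Suc j))" "X (p (Suc j)) \<le> X (p j) + 1"
     "Y (p j) \<le> Y (p (Suc j))" "Y (p (Suc j)) \<le> Y (p j) + 1" if "j < L" for j
    using s that by (auto simp: staircase_def)
  show False
  proof (cases "X z < X (p k) - 1")
    case True
    \<comment> \<open>\<open>z'\<close> has slipped below \<open>p k\<close>. Going back along the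
      staircase it stays below every earlier vertex, finally below the first one.\<close>
    have "Y z' < Y (p j) - 1 \<and> X (p j) - 1 \<le> X z' \<and> X z' < X (p j)" if "j \<le> k" for j
      using that
    proof (induction j rule: inc_induct)
      case base show ?case using True k zz n [OF k(1)] unfolding near_def by (smt (verit))
    next
      case (step j)
      then have "j < L" "j \<le> L" using k by auto
      then show ?case using st [of j] ab [of j] n [of j] zz step.IH unfolding near_def by (smt (verit))
    qed
    from this [of 0] show False using e by simp
  next
    case False
    \<comment> \<open>The mirrored case: \<open>z'\<close> has passed to the right of
      \<open>p k\<close> and stays to the right of all later vertices, finally of the last
      one.\<close>
    have "X (p j) + 1 < X z' \<and> Y z' \<le> Y (p j) + 1 \<and> Y (p j) < Y z'" if "k \<le> j" "j \<le> L" for j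
      using that
    proof (induction j rule: dec_induct)
      case base show ?case using False k ab [OF k(1)] zz n [OF k(1)] unfolding near_def by (smt (verit))
    next
      case (step j)
      then have j: "j < L" "Suc j \<le> L" "j \<le> L" by auto
      have IH: "X (p j) + 1 < X z'" "Y z' \<le> Y (p j) + 1" using step.IH j(3) by auto
      have "\<not> (\<bar>X (p (Suc j)) - X z'\<bar> \<le> 1 \<and> \<bar>Y (p (Suc j)) - Y z'\<bar> \<le> 1)"
        using n [OF j(2)] by (simp add: near_def)
      then show ?case using st [OF j(1)] ab [OF j(2)] zz IH by argo
    qed
    from this [of L] show False using e k by simp
  qed
qed

lemma above_walk:
  assumes s: "staircase X Y p L" and a: "above X Y p L (g 0)"
    and z: "\<And>k. k < K \<Longrightarrow> near X Y (g k) (g (Suc k))"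
    and n: "\<And>k j. j \<le> K \<Longrightarrow> k \<le> L \<Longrightarrow> \<not> near X Y (p k) (g j)"
    and e: "\<And>j. j \<le> K \<Longrightarrow> Y (p 0) - 1 \<le> Y (g j)" "\<And>j. j \<le> K \<Longrightarrow> X (g j) \<le> X (p L) + 1"
    and "j \<le> K"
  shows "above X Y p L (g j)"
  using \<open>j \<le> K\<close>
proof (induction j)
  case 0 then show ?case using a by simp
next
  case (Suc j) then show ?case
    using above_step [OF s, of "g j" "g (Suc j)"] z [of j] n [of "Suc j"] e [of "Suc j"] by simp
qed

section \<open>The lower bound graph\<close>

text \<open>Sites of the lower bound graph. \<open>Frame i j\<close> is a lattice point of two horizontal strips (rows 2, 3 and
  40, 41) that are joined by two vertical strips (columns 0, 1 and \<open>N - 1, N\<close>). The ladder of the \<open>Slack k b\<close>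
  joins the lower corners of this frame and is about four times as long as a strip. The \<open>t\<close>-th bit decides
  in which column \<open>ca t\<close> a two column wide tooth \<open>Tooth t c r\<close> stands on row 3, and in which columns
  from \<open>cb t\<close> on a patch \<open>Patch t c r\<close> hangs from row 40. The path of the \<open>Tail k\<close> pads the graph to
  the required number of vertices.\<close>

datatype vert = Frame nat nat | Slack nat nat | Tooth nat nat nat | Patch nat nat nat | Tail nat

definition consec :: "nat \<Rightarrow> nat \<Rightarrow> bool" where
  "consec a b \<longleftrightarrow> a = Suc b \<or> b = Suc a"

fun valid_site :: "nat \<Rightarrow> nat \<Rightarrow> nat \<Rightarrow> vert \<Rightarrow> bool" where
  "valid_site N m T (Frame i j) \<longleftrightarrow> i \<le> N \<and> j \<le> 41 \<and> (i \<le> 1 \<or> N \<le> Suc i \<or> j \<in> {2, 3, 40, 41})"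
| "valid_site N m T (Slack k b) \<longleftrightarrow> 2 \<le> k \<and> k + 15 \<le> 4 * N \<and> b \<le> 1"
| "valid_site N m T (Tooth t c r) \<longleftrightarrow> t < m \<and> c \<le> 1 \<and> 1 \<le> r \<and> r \<le> 100"
| "valid_site N m T (Patch t c r) \<longleftrightarrow> t < m \<and> c \<le> 424 \<and> 1 \<le> r \<and> r \<le> 100"
| "valid_site N m T (Tail k) \<longleftrightarrow> k < T"

fun link :: "nat \<Rightarrow> (nat \<Rightarrow> nat) \<Rightarrow> (nat \<Rightarrow> nat) \<Rightarrow> vert \<Rightarrow> vert \<Rightarrow> bool" where
  "link N ca cb (Frame i j) (Frame i' j') \<longleftrightarrow> i = i' \<and> consec j j' \<or> j = j' \<and> consec i i'"
| "link N ca cb (Slack k b) (Slack k' b') \<longleftrightarrow> k = k' \<and> consec b b' \<or> b = b' \<and> consec k k'"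
| "link N ca cb (Tooth t c r) (Tooth t' c' r') \<longleftrightarrow> t = t' \<and> (c = c' \<and> consec r r' \<or> r = r' \<and> consec c c')"
| "link N ca cb (Patch t c r) (Patch t' c' r') \<longleftrightarrow> t = t' \<and> (c = c' \<and> consec r r' \<or> r = r' \<and> consec c c')"
| "link N ca cb (Tail k) (Tail k') \<longleftrightarrow> consec k k'"
| "link N ca cb (Frame i j) (Slack k b) \<longleftrightarrow> j = b \<and> (i = 1 \<and> k = 2 \<or> Suc i = N \<and> k + 15 = 4 * N)"
| "link N ca cb (Frame i j) (Tooth t c r) \<longleftrightarrow> j = 3 \<and> r = 1 \<and> i = ca t + c"
| "link N ca cb (Frame i j) (Patch t c r) \<longleftrightarrow> j = 40 \<and> r = 1 \<and> i = cb t + c"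
| "link N ca cb (Frame i j) (Tail k) \<longleftrightarrow> i = 0 \<and> j = 0 \<and> k = 0"
| "link N ca cb _ _ \<longleftrightarrow> False"

definition adj :: "nat \<Rightarrow> (nat \<Rightarrow> nat) \<Rightarrow> (nat \<Rightarrow> nat) \<Rightarrow> vert \<Rightarrow> vert \<Rightarrow> bool" where
  "adj N ca cb u v \<longleftrightarrow> link N ca cb u v \<or> link N ca cb v u"

text \<open>An arbitrary realisation, normalised by \<open>ex_tilted\<close>. The orientation of
  this single cell spreads over all ladders of the graph.\<close>

locale tilted_drawing =
  fixes X Y :: "vert \<Rightarrow> real" and N m T :: nat and ca cb :: "nat \<Rightarrow> nat"
  assumes drawn: "\<And>u v. valid_site N m T u \<Longrightarrow> valid_site N m T v \<Longrightarrow> u \<noteq> v \<Longrightarrow> near X Y u v \<longleftrightarrow> adj N ca cb u v"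
    and N: "1000 \<le> N"
    and tilt: "tilted X Y (Frame 0 0) (Frame 1 0) (Frame 1 1) (Frame 0 1)"
begin

lemma ladderI:
  assumes "\<And>k. k \<le> L \<Longrightarrow> valid_site N m T (g k) \<and> valid_site N m T (h k) \<and> adj N ca cb (g k) (h k) \<and> g k \<noteq> h k"
    and "\<And>k. k < L \<Longrightarrow> adj N ca cb (g k) (g (Suc k)) \<and> adj N ca cb (h k) (h (Suc k)) \<and>
      \<not> adj N ca cb (g k) (h (Suc k)) \<and> \<not> adj N ca cb (g (Suc k)) (h k) \<and>
      g k \<noteq> g (Suc k) \<and> h k \<noteq> h (Suc k) \<and> g k \<noteq> h (Suc k) \<and> g (Suc k) \<noteq> h k"
    and "\<And>k. Suc (Suc k) \<le> L \<Longrightarrow> \<not> adj N ca cb (g k) (g (Suc (Suc k))) \<and> g k \<noteq> g (Suc (Suc k))"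
  shows "ladder X Y g h L"
  unfolding ladder_def
proof (intro conjI allI impI)
  fix k assume "k < L"
  then have *: "k \<le> L" "Suc k \<le> L" by auto
  show "near X Y (g k) (g (Suc k))" "near X Y (h k) (h (Suc k))"
      "\<not> near X Y (g k) (h (Suc k))" "\<not> near X Y (g (Suc k)) (h k)"
    using assms(1) [OF *(1)] assms(1) [OF *(2)] assms(2) [OF \<open>k < L\<close>] drawn by simp_all
next
  fix k assume "k \<le> L"
  then show "near X Y (g k) (h k)" using assms(1) [of k] drawn by simp
next
  fix k assume k: "Suc (Suc k) \<le> L"
  then have "k \<le> L" by simp
  then show "\<not> near X Y (g k) (g (Suc (Suc k)))"
    using assms(1) [of k] assms(1) [OF k] assms(3) [OF k] drawn by simp
qed

section \<open>Orientation of the frame and the slack ladder\<close>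

lemma spine: "ladder X Y (Frame 0) (Frame 1) 41"
  by (rule ladderI) (use N in \<open>auto simp: adj_def consec_def\<close>)

lemma spine_tilted: "j < 41 \<Longrightarrow> tilted X Y (Frame 0 j) (Frame 1 j) (Frame 1 (Suc j)) (Frame 0 (Suc j))"
  using ladder_up [OF spine] tilt by simp

lemma row: "j \<in> {2, 40} \<Longrightarrow> ladder X Y (\<lambda>i. Frame i j) (\<lambda>i. Frame i (Suc j)) N"
  by (rule ladderI) (auto simp: adj_def consec_def)

lemma row_tilted:
  assumes "j \<in> {2, 40}" "i < N"
  shows "tilted X Y (Frame i j) (Frame (Suc i) j) (Frame (Suc i) (Suc j)) (Frame i (Suc j))"
  using ladder_right [OF row [OF assms(1)] _ assms(2)] spine_tilted [of j] assms by auto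

lemma closing_up: "ladder X Y (\<lambda>j. Frame (N - 1) (2 + j)) (\<lambda>j. Frame N (2 + j)) 39"
  by (rule ladderI) (use N in \<open>auto simp: adj_def consec_def\<close>)

lemma closing_down: "ladder X Y (\<lambda>j. Frame (N - 1) (3 - j)) (\<lambda>j. Frame N (3 - j)) 3"
  by (rule ladderI) (use N in \<open>auto simp: adj_def consec_def\<close>)

lemma closing_up_start: "tilted X Y (Frame (N - 1) 2) (Frame N 2) (Frame N 3) (Frame (N - 1) 3)"
proof -
  have e: "Suc (N - 1) = N" "Suc 2 = (3 :: nat)" using N by auto
  show ?thesis using row_tilted [of 2 "N - 1"] N unfolding e by simp
qed

lemma closing_order:
  assumes "j < 41"
  shows "X (Frame N (Suc j)) < X (Frame N j)" "X (Frame N j) \<le> X (Frame N (Suc j)) + 1"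
    "Y (Frame N j) < Y (Frame N (Suc j))" "Y (Frame N (Suc j)) \<le> Y (Frame N j) + 1"
proof -
  have up: "X (Frame N (Suc j)) < X (Frame N j)" "X (Frame N j) \<le> X (Frame N (Suc j)) + 1"
    "Y (Frame N j) < Y (Frame N (Suc j))" "Y (Frame N (Suc j)) \<le> Y (Frame N j) + 1" if j2: "2 \<le> j"
  proof -
    have t: "tilted X Y (Frame (N - 1) (2 + 0)) (Frame N (2 + 0)) (Frame N (2 + 1)) (Frame (N - 1) (2 + 1))"
      using closing_up_start by simp
    obtain i where i: "j = 2 + i" using le_Suc_ex [OF j2] by blast
    have e: "2 + Suc i = Suc j" "2 + i = j" "i < 39" using i assms by auto
    note o = ladder_up_order(5-8) [OF closing_up t e(3), unfolded e(1,2)]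
    show "X (Frame N (Suc j)) < X (Frame N j)" "X (Frame N j) \<le> X (Frame N (Suc j)) + 1"
      "Y (Frame N j) < Y (Frame N (Suc j))" "Y (Frame N (Suc j)) \<le> Y (Frame N j) + 1"
      by (fact o)+
  qed
  have dn: "X (Frame N (Suc j)) < X (Frame N j)" "X (Frame N j) \<le> X (Frame N (Suc j)) + 1"
    "Y (Frame N j) < Y (Frame N (Suc j))" "Y (Frame N (Suc j)) \<le> Y (Frame N j) + 1" if "j < 2"
  proof -
    have "3 - (2 - j) = Suc j" "3 - Suc (2 - j) = j" "2 - j < 3" using that by auto
    then show "X (Frame N (Suc j)) < X (Frame N j)" "X (Frame N j) \<le> X (Frame N (Suc j)) + 1"
      "Y (Frame N j) < Y (Frame N (Suc j))" "Y (Frame N (Suc j)) \<le> Y (Frame N j) + 1"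
      using ladder_down_order(5-8) [OF closing_down, of "2 - j"] closing_up_start by simp_all
  qed
  from up dn show "X (Frame N (Suc j)) < X (Frame N j)" "X (Frame N j) \<le> X (Frame N (Suc j)) + 1"
    "Y (Frame N j) < Y (Frame N (Suc j))" "Y (Frame N (Suc j)) \<le> Y (Frame N j) + 1" by (meson not_le)+
qed

text \<open>The slack ladder extended by two rungs of the frame at either end, so that it starts
  with the normalised cell. The shift \<open>k + 13 - 3 * N\<close> sends \<open>4 * N - 14\<close>
  and \<open>4 * N - 13\<close> to the columns \<open>N - 1\<close> and \<open>N\<close>.\<close>

definition sl :: "nat \<Rightarrow> nat \<Rightarrow> vert" where
  "sl b k = (if k \<le> 1 then Frame k b else if k + 15 \<le> 4 * N then Slack k b else Frame (k + 13 - 3 * N) b)"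

lemma slack: "ladder X Y (sl 0) (sl 1) (4 * N - 13)"
proof (rule ladderI)
  fix k assume "k \<le> 4 * N - 13"
  then consider "k \<le> 1" | "2 \<le> k" "k + 15 \<le> 4 * N" | "k = 4 * N - 14" | "k = 4 * N - 13" by linarith
  then show "valid_site N m T (sl 0 k) \<and> valid_site N m T (sl 1 k) \<and> adj N ca cb (sl 0 k) (sl 1 k) \<and> sl 0 k \<noteq> sl 1 k"
    using N by cases (auto simp: sl_def adj_def consec_def)
next
  fix k assume "k < 4 * N - 13"
  then consider "k = 0" | "k = 1" | "2 \<le> k" "k + 16 \<le> 4 * N" | "k = 4 * N - 15" | "k = 4 * N - 14" by linarith
  then show "adj N ca cb (sl 0 k) (sl 0 (Suc k)) \<and> adj N ca cb (sl 1 k) (sl 1 (Suc k)) \<and>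
      \<not> adj N ca cb (sl 0 k) (sl 1 (Suc k)) \<and> \<not> adj N ca cb (sl 0 (Suc k)) (sl 1 k) \<and>
      sl 0 k \<noteq> sl 0 (Suc k) \<and> sl 1 k \<noteq> sl 1 (Suc k) \<and> sl 0 k \<noteq> sl 1 (Suc k) \<and> sl 0 (Suc k) \<noteq> sl 1 k"
    using N by cases (auto simp: sl_def adj_def consec_def)
next
  fix k assume "Suc (Suc k) \<le> 4 * N - 13"
  then consider "k = 0" | "k = 1" | "2 \<le> k" "k + 17 \<le> 4 * N" | "k = 4 * N - 16" | "k = 4 * N - 15" by linarith
  then show "\<not> adj N ca cb (sl 0 k) (sl 0 (Suc (Suc k))) \<and> sl 0 k \<noteq> sl 0 (Suc (Suc k))"
    using N by cases (auto simp: sl_def adj_def consec_def)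
qed

text \<open>Every second vertex of the slack ladder increases \<open>X + Y\<close> by more than 1, whereas a row of the frame
  allows each of \<open>X\<close> and \<open>Y\<close> to increase by at most \<open>N\<close>. These bounds meet up to a constant, which
  pins the rows of the frame to a diagonal.\<close>

lemma far_end:
  shows "X (Frame N 0) \<le> X (Frame 0 0) + N + 2" "Y (Frame N 0) \<le> Y (Frame 0 0) + N + 2"
    "X (Frame 0 0) + N - 9 \<le> X (Frame N 0)" "Y (Frame 0 0) + N - 9 \<le> Y (Frame N 0)"
proof -
  have t: "tilted X Y (sl 0 0) (sl 0 1) (sl 1 1) (sl 1 0)" using tilt by (simp add: sl_def)
  note o = ladder_right_order [OF slack t]
  have sum: "X (sl 0 k) + Y (sl 0 k) + 1 < X (sl 0 (Suc (Suc k))) + Y (sl 0 (Suc (Suc k)))"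
    if "Suc (Suc k) \<le> 4 * N - 13" for k
  proof -
    have "\<not> near X Y (sl 0 k) (sl 0 (Suc (Suc k)))" using slack that by (simp add: ladder_def)
    then show ?thesis using o(1,3) [of k] o(1,3) [of "Suc k"] that unfolding near_def by linarith
  qed
  \<comment> \<open>The first \<open>4 * N - 14\<close> steps are taken in \<open>2 * N - 7\<close>
    pairs. Their number \<open>4 * N - 13\<close> is odd, and for the last step monotonicity is
    enough.\<close>
  have "X (sl 0 0) + Y (sl 0 0) + real (2 * N - 7) \<le> X (sl 0 (0 + 2 * (2 * N - 7))) + Y (sl 0 (0 + 2 * (2 * N - 7)))"
    by (rule two_step_growth [where s = "\<lambda>k. X (sl 0 k) + Y (sl 0 k)", OF sum]) auto
  moreover have e: "0 + 2 * (2 * N - 7) = 4 * N - 14" "Suc (4 * N - 14) = 4 * N - 13" using N by auto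
  moreover have "X (sl 0 (4 * N - 14)) < X (sl 0 (4 * N - 13))" "Y (sl 0 (4 * N - 14)) < Y (sl 0 (4 * N - 13))"
    using o(1,3) [of "4 * N - 14"] e N by simp_all
  moreover have "sl 0 (4 * N - 13) = Frame N 0" "sl 0 0 = Frame 0 0" using N by (auto simp: sl_def)
  ultimately have s: "X (Frame 0 0) + Y (Frame 0 0) + 2 * real N - 7 \<le> X (Frame N 0) + Y (Frame N 0)"
    using N by (simp add: of_nat_diff)
  have r: "X (Frame N 2) \<le> X (Frame 0 2) + N" "Y (Frame N 2) \<le> Y (Frame 0 2) + N"
    using slow_mono(2) [of N "\<lambda>i. X (Frame i 2)" 0 N] slow_mono(2) [of N "\<lambda>i. Y (Frame i 2)" 0 N]
      ladder_right_order(1-4) [OF row [of 2]] row_tilted [of 2 0] N by auto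
  note sp = ladder_up_order(1-4) [OF spine, simplified, OF spine_tilted [of 0, simplified]]
  have "X (Frame 0 2) \<le> X (Frame 0 0)" "Y (Frame 0 2) \<le> Y (Frame 0 0) + 2"
    using sp [of 0] sp [of 1] by (simp_all add: numeral_2_eq_2)
  moreover have "X (Frame N 0) \<le> X (Frame N 2) + 2" "Y (Frame N 0) \<le> Y (Frame N 2)"
    using closing_order [of 0] closing_order [of 1] by (simp_all add: numeral_2_eq_2)
  ultimately show 1: "X (Frame N 0) \<le> X (Frame 0 0) + N + 2" "Y (Frame N 0) \<le> Y (Frame 0 0) + N + 2"
    using r by linarith+
  \<comment> \<open>The sum grows by at least \<open>2 * N - 7\<close> and the other coordinate by
    at most \<open>N + 2\<close>.\<close>
  show "X (Frame 0 0) + N - 9 \<le> X (Frame N 0)" "Y (Frame 0 0) + N - 9 \<le> Y (Frame N 0)"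
    using 1 s by linarith+
qed

lemma row_order:
  assumes "j \<in> {3, 40}" "i < N"
  shows "X (Frame i j) < X (Frame (Suc i) j)" "X (Frame (Suc i) j) \<le> X (Frame i j) + 1"
    "Y (Frame i j) < Y (Frame (Suc i) j)" "Y (Frame (Suc i) j) \<le> Y (Frame i j) + 1"
  using assms ladder_right_order [OF row [of 2]] ladder_right_order [OF row [of 40]] 
    row_tilted [of 2 0] row_tilted [of 40 0] N by auto

lemma spine_order:
  assumes "j \<le> 41"
  shows "X (Frame 0 j) \<le> X (Frame 0 0)" "X (Frame 0 0) \<le> X (Frame 0 j) + j" "Y (Frame 0 0) \<le> Y (Frame 0 j)" "Y (Frame 0 j) \<le> Y (Frame 0 0) + j"
proof -
  note sp = ladder_up_order(1-4) [OF spine, simplified, OF spine_tilted [of 0, simplified]]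
  show "X (Frame 0 j) \<le> X (Frame 0 0)" "X (Frame 0 0) \<le> X (Frame 0 j) + j" "Y (Frame 0 0) \<le> Y (Frame 0 j)" "Y (Frame 0 j) \<le> Y (Frame 0 0) + j"
    using slow_antimono [of 41 "\<lambda>i. X (Frame 0 i)" 0 j] slow_mono [of 41 "\<lambda>i. Y (Frame 0 i)" 0 j] sp assms by auto
qed

lemma closing_order_le:
  assumes "i \<le> j" "j \<le> 41"
  shows "X (Frame N j) \<le> X (Frame N i)" "X (Frame N i) \<le> X (Frame N j) + (real j - real i)" "Y (Frame N i) \<le> Y (Frame N j)"
  using slow_antimono [of 41 "\<lambda>i. X (Frame N i)" i j] slow_mono [of 41 "\<lambda>i. Y (Frame N i)" i j] closing_order assms by force+

text \<open>A path with steps of at most 1 that gains about \<open>N\<close> in \<open>N\<close>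
  steps can never lag by more than a constant. The terms in \<open>j\<close> come from the vertical
  strips at both ends.\<close>

lemma row_bounds:
  assumes "j \<in> {3, 40}" "i \<le> N"
  shows "X (Frame i j) \<le> X (Frame 0 0) + i" "X (Frame 0 0) + i - j - 9 \<le> X (Frame i j)"
    "Y (Frame 0 0) + i - 9 \<le> Y (Frame i j)" "Y (Frame i j) \<le> Y (Frame 0 0) + i + j"
proof -
  have j: "j \<le> 41" using assms by auto
  have "X (Frame i j) \<le> X (Frame 0 j) + i" "Y (Frame i j) \<le> Y (Frame 0 j) + i"
    "X (Frame N j) \<le> X (Frame i j) + (real N - i)" "Y (Frame N j) \<le> Y (Frame i j) + (real N - i)"
    using slow_mono(2) [of N "\<lambda>i. X (Frame i j)" 0 i] slow_mono(2) [of N "\<lambda>i. Y (Frame i j)" 0 i]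
      slow_mono(2) [of N "\<lambda>i. X (Frame i j)" i N] slow_mono(2) [of N "\<lambda>i. Y (Frame i j)" i N]
      row_order assms by auto
  then show "X (Frame i j) \<le> X (Frame 0 0) + i" "X (Frame 0 0) + i - j - 9 \<le> X (Frame i j)"
    "Y (Frame 0 0) + i - 9 \<le> Y (Frame i j)" "Y (Frame i j) \<le> Y (Frame 0 0) + i + j"
    using spine_order [OF j] closing_order_le [of 0 j, OF _ j] far_end by linarith+
qed

section \<open>Separation of the rows and conflict of the gadgets\<close>

lemma row_staircase: "staircase X Y (\<lambda>i. Frame i 3) N"
  using row_order [of 3] by (simp add: staircase_def less_imp_le)

text \<open>The left strip puts the start of row 40 to the north-west of row 3. Being monotone, row
  40 stays above the level of its start, and the right strip bounds its other end, so it can get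
  around neither end of row 3.\<close>

lemma upper_row_above:
  assumes "i \<le> N"
  shows "above X Y (\<lambda>i. Frame i 3) N (Frame i 40)"
proof (rule above_walk [OF row_staircase, of "\<lambda>i. Frame i 40", OF _ _ _ _ _ assms])
  have n: "\<not> near X Y (Frame k 3) (Frame j 40)" if "j \<le> N" "k \<le> N" for j k
    using drawn [of "Frame k 3" "Frame j 40"] that by (simp add: adj_def consec_def)
  then show "\<And>k j. j \<le> N \<Longrightarrow> k \<le> N \<Longrightarrow> \<not> near X Y (Frame k 3) (Frame j 40)" .
  note sp = ladder_up_order(1-4) [OF spine, simplified, OF spine_tilted [of 0, simplified]]
  have s: "X (Frame 0 40) \<le> X (Frame 0 3)" "Y (Frame 0 3) \<le> Y (Frame 0 40)"
    using slow_antimono(1) [of 41 "\<lambda>i. X (Frame 0 i)" 3 40] slow_mono(1) [of 41 "\<lambda>i. Y (Frame 0 i)" 3 40] sp by auto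
  show "above X Y (\<lambda>i. Frame i 3) N (Frame 0 40)"
    by (rule above_start [OF row_staircase s]) (use n in simp)
  show "near X Y (Frame k 40) (Frame (Suc k) 40)" if "k < N" for k
    using drawn [of "Frame k 40" "Frame (Suc k) 40"] that by (simp add: adj_def consec_def)
  show "Y (Frame 0 3) - 1 \<le> Y (Frame j 40)" if "j \<le> N" for j
    using slow_mono(1) [of N "\<lambda>i. Y (Frame i 40)" 0 j] row_order [of 40] s that by force
  show "X (Frame j 40) \<le> X (Frame N 3) + 1" if "j \<le> N" for j
    using slow_mono(1) [of N "\<lambda>i. X (Frame i 40)" j N] row_order [of 40] closing_order_le [of 3 40] that by force
qed

text \<open>If the tooth stands below the middle of the patch, then their heights of 50 each overlap, as the pinned
  rows 3 and 40 differ in \<open>Y - X\<close> by less than 100. But the tooth starts below the bottom row of the patch and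
  is too short to walk around it.\<close>

lemma no_conflict:
  assumes t: "t < m" and lo: "488 \<le> cb t" and hi: "cb t + 700 \<le> N" and ca: "ca t = cb t + 212"
  shows False
proof -
  \<comment> \<open>Both gadgets are extended by two rows of the frame: their common cells hand the
    orientation of the rows over to the gadgets.\<close>
  define to where "to c r = (if r \<le> 1 then Frame (ca t + c) (r + 2) else Tooth t c (r - 1))" for c r
  define pa where "pa c r = (if r \<le> 1 then Frame (cb t + c) (41 - r) else Patch t c (r - 1))" for c r
  define b where "b c = Patch t c 100" for c
  have to_ladder: "ladder X Y (to 0) (to 1) 101"
    by (rule ladderI) (use t hi ca in \<open>auto simp: to_def adj_def consec_def\<close>)
  have to_start: "tilted X Y (to 0 0) (to 1 0) (to 1 1) (to 0 1)"
    using row_tilted [of 2 "ca t"] ca hi by (simp add: to_def eval_nat_numeral)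
  note to_order = ladder_up_order(1-4) [OF to_ladder to_start]
  have pa_ladder: "ladder X Y (pa c) (pa (Suc c)) 101" if "c < 424" for c
    by (rule ladderI) (use t hi that in \<open>auto simp: pa_def adj_def consec_def\<close>)
  have pa_start: "tilted X Y (pa c 1) (pa (Suc c) 1) (pa (Suc c) 0) (pa c 0)" if "c < 424" for c
    using row_tilted [of 40 "cb t + c"] that hi by (simp add: pa_def)
  have pa_order: "X (pa c k) < X (pa c (Suc k))" "X (pa c (Suc k)) \<le> X (pa c k) + 1"
      "Y (pa c (Suc k)) < Y (pa c k)" "Y (pa c k) \<le> Y (pa c (Suc k)) + 1" if "c \<le> 424" "k < 101" for c k
  proof -
    have "X (pa c k) < X (pa c (Suc k)) \<and> X (pa c (Suc k)) \<le> X (pa c k) + 1 \<and>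
      Y (pa c (Suc k)) < Y (pa c k) \<and> Y (pa c k) \<le> Y (pa c (Suc k)) + 1"
    proof (cases "c < 424")
      case True
      show ?thesis using ladder_down_order(1-4) [OF pa_ladder [OF True] pa_start [OF True] that(2)] by blast
    next
      case False
      \<comment> \<open>The last column starts no ladder of its own; it is the second rail of the
        ladder of column 423.\<close>
      then have c: "Suc 423 = c" and l: "(423 :: nat) < 424" using that by auto
      show ?thesis using ladder_down_order(5-8) [OF pa_ladder [OF l] pa_start [OF l] that(2), unfolded c] by blast
    qed
    then show "X (pa c k) < X (pa c (Suc k))" "X (pa c (Suc k)) \<le> X (pa c k) + 1"
      "Y (pa c (Suc k)) < Y (pa c k)" "Y (pa c k) \<le> Y (pa c (Suc k)) + 1" by auto
  qed
  have pa1: "pa c 1 = Frame (cb t + c) 40" and pab: "pa c 101 = b c" for c by (simp_all add: pa_def b_def)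
  have to1: "to 0 1 = Frame (ca t) 3" by (simp add: to_def)
  have pa_pos: "X (pa c 1) \<le> X (pa c r)" "X (pa c r) \<le> X (pa c 1) + 100" "Y (pa c 1) - 100 \<le> Y (pa c r)"
    if c: "c \<le> 424" and r: "1 \<le> r" "r \<le> 101" for c r
    using slow_mono [of 101 "\<lambda>r. X (pa c r)" 1 r] slow_antimono [of 101 "\<lambda>r. Y (pa c r)" 1 r]
      pa_order [OF c] r by fastforce+
  have to_pos: "X (to 0 r) \<le> X (to 0 1)" "X (to 0 1) - 100 \<le> X (to 0 r)" "Y (to 0 r) \<le> Y (to 0 1) + 100"
    if r: "1 \<le> r" "r \<le> 101" for r
    using slow_antimono [of 101 "\<lambda>r. X (to 0 r)" 1 r] slow_mono [of 101 "\<lambda>r. Y (to 0 r)" 1 r]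
      to_order r by fastforce+
  have row40: "X (pa c 1) \<le> X (Frame 0 0) + cb t + c" "X (Frame 0 0) + cb t + c - 49 \<le> X (pa c 1)"
    "Y (Frame 0 0) + cb t + c - 9 \<le> Y (pa c 1)" "Y (pa c 1) \<le> Y (Frame 0 0) + cb t + c + 40" if "c \<le> 424" for c
    unfolding pa1 using row_bounds [of 40 "cb t + c"] that hi by simp_all
  have row3: "X (to 0 1) \<le> X (Frame 0 0) + cb t + 212" "X (Frame 0 0) + cb t + 200 \<le> X (to 0 1)"
    "Y (Frame 0 0) + cb t + 203 \<le> Y (to 0 1)" "Y (to 0 1) \<le> Y (Frame 0 0) + cb t + 215"
    unfolding to1 using row_bounds [of 3 "ca t"] hi by (simp_all add: ca)
  have pa_depth: "Y (b c) - X (b c) + 50 \<le> Y (pa c 1) - X (pa c 1)" if c: "c \<le> 424" for c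
  proof -
    have "X (pa c k) - Y (pa c k) + 1 < X (pa c (Suc (Suc k))) - Y (pa c (Suc (Suc k)))" if "Suc (Suc k) \<le> 101" for k
    proof -
      have "\<not> near X Y (pa c k) (pa c (Suc (Suc k)))"
      proof -
        have "valid_site N m T (pa c k)" "valid_site N m T (pa c (Suc (Suc k)))" 
          using that t c hi by (auto simp: pa_def)
        moreover consider "k = 0" | "k = 1" | "2 \<le> k" by linarith
        then have "pa c k \<noteq> pa c (Suc (Suc k)) \<and> \<not> adj N ca cb (pa c k) (pa c (Suc (Suc k)))"
          by cases (auto simp: pa_def adj_def consec_def)
        ultimately show ?thesis using drawn by blast
      qed
      then show ?thesis using pa_order [OF c, of k] pa_order [OF c, of "Suc k"] that unfolding near_def by linarith
    qed
    from two_step_growth [of 101 "\<lambda>k. X (pa c k) - Y (pa c k)", OF this, of 1 50]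
    show ?thesis by (simp add: pab)
  qed
  have to_height: "Y (to 0 1) - X (to 0 1) + 50 \<le> Y (to 0 101) - X (to 0 101)"
  proof -
    have "Y (to 0 k) - X (to 0 k) + 1 < Y (to 0 (Suc (Suc k))) - X (to 0 (Suc (Suc k)))" if "Suc (Suc k) \<le> 101" for k
    proof -
      have "\<not> near X Y (to 0 k) (to 0 (Suc (Suc k)))" using to_ladder that by (simp add: ladder_def)
      then show ?thesis using to_order [of k] to_order [of "Suc k"] that unfolding near_def by linarith
    qed
    from two_step_growth [of 101 "\<lambda>k. Y (to 0 k) - X (to 0 k)", OF this, of 1 50]
    show ?thesis by simp
  qed
  have b_step: "X (b c) < X (b (Suc c)) \<and> X (b (Suc c)) \<le> X (b c) + 1 \<and> Y (b c) < Y (b (Suc c)) \<and> Y (b (Suc c)) \<le> Y (b c) + 1"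
    if c: "c < 424" for c
  proof -
    have "near X Y (b c) (b (Suc c))" using drawn [of "b c" "b (Suc c)"] c t by (simp add: b_def adj_def consec_def)
    moreover have "X (b c) < X (b (Suc c))" "Y (b c) < Y (b (Suc c))"
      using ladder_down_order(9,10) [OF pa_ladder [OF c] pa_start [OF c], of 100] by (simp_all add: pab [symmetric])
    ultimately show ?thesis unfolding near_def by linarith
  qed
  have b_above: "above X Y (\<lambda>i. Frame i 3) N (b c)" if c: "c \<le> 424" for c
  proof -
    have "above X Y (\<lambda>i. Frame i 3) N ((\<lambda>r. pa c (Suc r)) 100)"
    proof (rule above_walk [OF row_staircase, where K = 100 and g = "\<lambda>r. pa c (Suc r)"])
      show "above X Y (\<lambda>i. Frame i 3) N (pa c (Suc 0))"
        using upper_row_above [of "cb t + c"] c hi by (simp add: pa1 [simplified])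
      show "near X Y (pa c (Suc k)) (pa c (Suc (Suc k)))" if "k < 100" for k
        using drawn [of "pa c (Suc k)" "pa c (Suc (Suc k))"] that c t hi
        by (auto simp: pa_def adj_def consec_def split: if_splits)
      show "\<not> near X Y (Frame k 3) (pa c (Suc j))" if "j \<le> 100" "k \<le> N" for k j
        using drawn [of "Frame k 3" "pa c (Suc j)"] that c t hi by (auto simp: pa_def adj_def consec_def split: if_splits)
      show "Y (Frame 0 3) - 1 \<le> Y (pa c (Suc j))" if "j \<le> 100" for j
        using pa_pos [OF c, of "Suc j"] row40 [OF c] spine_order(4) [of 3] lo that by simp
      show "X (pa c (Suc j)) \<le> X (Frame N 3) + 1" if "j \<le> 100" for j
        using pa_pos [OF c, of "Suc j"] row40 [OF c] row_bounds(2) [of 3 N] hi c that by simp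
    qed simp
    then show ?thesis by (simp add: pab)
  qed
  have nc: "near Y X = near X Y" by (auto simp: near_def fun_eq_iff)
  \<comment> \<open>Exchanging the coordinates reflects the plane in the diagonal, so this puts the
    tooth to the lower right of the bottom row of the patch. It starts there because that row is
    above row 3.\<close>
  have "above Y X b 424 ((\<lambda>r. to 0 (Suc r)) 100)"
  proof (rule above_walk [where K = 100 and g = "\<lambda>r. to 0 (Suc r)"])
    show "staircase Y X b 424" using b_step by (auto simp: staircase_def less_imp_le)
    show "above Y X b 424 (to 0 (Suc 0))"
      unfolding above_def
    proof (intro allI impI)
      fix k :: nat assume "k \<le> 424"
      then have "X (b k) < X (Frame (ca t) 3) - 1 \<or> Y (Frame (ca t) 3) + 1 < Y (b k)"
        using b_above [of k] hi ca unfolding above_def by simp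
      then show "Y (to 0 (Suc 0)) < Y (b k) - 1 \<or> X (b k) + 1 < X (to 0 (Suc 0))"
        unfolding to1 [simplified] by linarith
    qed
    show "near Y X (to 0 (Suc k)) (to 0 (Suc (Suc k)))" if "k < 100" for k
      using to_ladder that by (simp add: nc ladder_def)
    show "\<not> near Y X (b k) (to 0 (Suc j))" if "j \<le> 100" "k \<le> 424" for k j
      using drawn [of "b k" "to 0 (Suc j)"] that t hi ca by (auto simp: nc to_def b_def adj_def consec_def split: if_splits)
    \<comment> \<open>Here the half width \<open>212 = 100 + 100 + (3 + 9)\<close> of the patch is
      used: the drifts of patch and tooth, and the pinning error of row 3. The other half makes room
      for \<open>Y\<close> at the right end.\<close>
    show "X (b 0) - 1 \<le> X (to 0 (Suc j))" if "j \<le> 100" for j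
      using pa_pos(2) [of 0 101] row40(1) [of 0] to_pos(2) [of "Suc j"] row3 that by (simp add: pab)
    show "Y (to 0 (Suc j)) \<le> Y (b 424) + 1" if "j \<le> 100" for j
      using pa_pos(3) [of 424 101] row40(3) [of 424] to_pos(3) [of "Suc j"] row3 that by (simp add: pab)
  qed simp
  then have below: "Y (to 0 101) < Y (b c) - 1 \<or> X (b c) + 1 < X (to 0 101)" if "c \<le> 424" for c
    using that unfolding above_def by simp
  \<comment> \<open>A discrete intermediate value argument: the top of the tooth lies over one step
    of the bottom row.\<close>
  have "\<exists>c<424. X (b c) \<le> X (to 0 101) \<and> X (to 0 101) < X (b (Suc c))"
  proof (rule ccontr)
    assume no: "\<not> ?thesis"
    have "X (b c) \<le> X (to 0 101)" if "c \<le> 424" for c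
      using that
    proof (induction c)
      case 0 show ?case using pa_pos(2) [of 0 101] row40(1) [of 0] to_pos(2) [of 101] row3 by (simp add: pab)
    next
      case (Suc c) then show ?case using no by force
    qed
    from this [of 424] show False
      using pa_pos(1) [of 424 101] row40(2) [of 424] to_pos(1) [of 101] row3 by (simp add: pab)
  qed
  then obtain c where c: "c < 424" "X (b c) \<le> X (to 0 101)" "X (to 0 101) < X (b (Suc c))" by blast
  then have "Y (to 0 101) < Y (b c) - 1" using below [of c] b_step [OF c(1)] by linarith
  \<comment> \<open>Measure \<open>Y - X\<close> relative to \<open>Frame 0 0\<close>. It is at
    least -9 at the foot of the tooth and at most 89 on row 40, so at the top of the tooth it is at
    least \<open>-9 + 50 = 41\<close>, but also less than \<open>89 - 50 - 1 = 38\<close>.\<close>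
  then show False using to_height pa_depth [of c] row40 [of c] row3 c by linarith
qed

end

section \<open>Realisations of the lower bound graph\<close>

text \<open>The slack ladder runs along a nearly horizontal and then a nearly vertical line, with steps only slightly
  longer than 1/2.\<close>

locale slack_path =
  fixes N :: nat
  assumes N5: "5 \<le> N"
begin

text \<open>Two equations determine these values: the extended ladder has
  \<open>2 * K + 3 = 4 * N - 13\<close> steps, and its total displacement
  \<open>3 + K / 2 + 2 * K * eta\<close> in each coordinate has to be \<open>N\<close>.\<close>

definition K :: nat where "K = 2 * N - 8"
definition eta :: real where "eta = 1 / (2 * real K)"

definition sx :: "nat \<Rightarrow> real" where
  "sx k = (if k = 0 \<or> k = K + 1 \<or> k = 2 * K + 2 then 1 else if k \<le> K then 1 / 2 + eta else eta)"
definition sy :: "nat \<Rightarrow> real" where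
  "sy k = (if k = 0 \<or> k = K + 1 \<or> k = 2 * K + 2 then 1 else if k \<le> K then eta else 1 / 2 + eta)"

definition vx :: "nat \<Rightarrow> real" where "vx k = (\<Sum>i<k. sx i)"
definition vy :: "nat \<Rightarrow> real" where "vy k = (\<Sum>i<k. sy i)"

lemma K: "2 \<le> K" "real K = 2 * real N - 8" "4 * N = 2 * K + 16"
  using N5 by (auto simp: K_def of_nat_diff)

lemma eta: "0 < eta" "eta \<le> 1 / 4" "real K * eta = 1 / 2"
  using K(1) by (auto simp: eta_def field_simps)

lemma v_Suc: "vx (Suc k) = vx k + sx k" "vy (Suc k) = vy k + sy k"
  by (simp_all add: vx_def vy_def)

lemma s_bounds: "0 < sx k" "sx k \<le> 1" "0 < sy k" "sy k \<le> 1"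
  using eta by (auto simp: sx_def sy_def)

lemma v_less: "i < j \<Longrightarrow> vx i < vx j" "i < j \<Longrightarrow> vy i < vy j"
  using lift_Suc_mono_less [of vx i j] lift_Suc_mono_less [of vy i j] s_bounds by (auto simp: v_Suc)

text \<open>Two steps of \<open>1 / 2 + eta\<close> exceed 1. The unit step at the corner is needed,
  as a short step in each direction would leave two rungs at distance 2 near each other.\<close>

lemma s_pair: "Suc (Suc k) \<le> 2 * K + 3 \<Longrightarrow> 1 < sx k + sx (Suc k) \<or> 1 < sy k + sy (Suc k)"
  using eta s_bounds [of k] s_bounds [of "Suc k"] by (auto simp: sx_def sy_def)

lemma v_apart:
  assumes "i < j" "j \<le> 2 * K + 3"
  shows "vx j - vx i \<le> 1 \<and> vy j - vy i \<le> 1 \<longleftrightarrow> j = Suc i"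
proof (cases "j = Suc i")
  case True then show ?thesis using s_bounds by (simp add: v_Suc)
next
  case False
  then have ij: "Suc (Suc i) \<le> j" using assms by simp
  have "vx (Suc (Suc i)) \<le> vx j" "vy (Suc (Suc i)) \<le> vy j"
    using ij v_less by (metis le_less_linear less_imp_le nat_less_le order_refl)+
  moreover have "1 < sx i + sx (Suc i) \<or> 1 < sy i + sy (Suc i)" using s_pair ij assms by simp
  ultimately show ?thesis using False by (auto simp: v_Suc)
qed

lemma v_first:
  assumes "k \<le> K"
  shows "vx (Suc k) = 1 + k * (1 / 2 + eta)" "vy (Suc k) = 1 + k * eta"
proof -
  have "vx (Suc k) = 1 + k * (1 / 2 + eta) \<and> vy (Suc k) = 1 + k * eta"
    using assms
  proof (induction k)
    case 0 show ?case by (simp add: vx_def vy_def sx_def sy_def)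
  next
    case (Suc k)
    then have IH: "vx (Suc k) = 1 + k * (1 / 2 + eta)" "vy (Suc k) = 1 + k * eta" by auto
    have s: "sx (Suc k) = 1 / 2 + eta" "sy (Suc k) = eta" using Suc.prems by (auto simp: sx_def sy_def)
    show ?case unfolding v_Suc [of "Suc k"] IH s by (simp add: distrib_right)
  qed
  then show "vx (Suc k) = 1 + k * (1 / 2 + eta)" "vy (Suc k) = 1 + k * eta" by auto
qed

lemma v_second:
  assumes "k \<le> K"
  shows "vx (K + 2 + k) = 5 / 2 + K / 2 + k * eta" "vy (K + 2 + k) = 5 / 2 + k * (1 / 2 + eta)"
proof -
  have "vx (K + 2 + k) = 5 / 2 + K / 2 + k * eta \<and> vy (K + 2 + k) = 5 / 2 + k * (1 / 2 + eta)"
    using assms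
  proof (induction k)
    case 0
    have e: "K + 2 + 0 = Suc (Suc K)" by simp
    have "vx (Suc (Suc K)) = 2 + K * (1 / 2 + eta)" "vy (Suc (Suc K)) = 2 + K * eta"
      using v_first [of K] by (simp_all add: v_Suc [of "Suc K"] sx_def sy_def)
    then show ?case unfolding e using eta(3) by (simp add: distrib_left)
  next
    case (Suc k)
    then have IH: "vx (K + 2 + k) = 5 / 2 + K / 2 + k * eta" "vy (K + 2 + k) = 5 / 2 + k * (1 / 2 + eta)" by auto
    have e: "K + 2 + Suc k = Suc (K + 2 + k)" by simp
    have s: "sx (K + 2 + k) = eta" "sy (K + 2 + k) = 1 / 2 + eta" using Suc.prems by (auto simp: sx_def sy_def)
    show ?case unfolding e v_Suc IH s by (simp add: distrib_right)
  qed
  then show "vx (K + 2 + k) = 5 / 2 + K / 2 + k * eta" "vy (K + 2 + k) = 5 / 2 + k * (1 / 2 + eta)" by auto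
qed

lemma v_ends: "vx 0 = 0" "vy 0 = 0" "vx 1 = 1" "vy 1 = 1"
    "vx (2 * K + 2) = real N - 1" "vy (2 * K + 2) = real N - 1" "vx (2 * K + 3) = N" "vy (2 * K + 3) = N"
proof -
  show "vx 0 = 0" "vy 0 = 0" "vx 1 = 1" "vy 1 = 1" by (simp_all add: vx_def vy_def sx_def sy_def)
  have e: "2 * K + 2 = K + 2 + K" "2 * K + 3 = Suc (2 * K + 2)" by auto
  have a: "real K * (1 / 2 + eta) = real K / 2 + 1 / 2" using eta(3) by (simp add: distrib_left)
  show 1: "vx (2 * K + 2) = real N - 1" "vy (2 * K + 2) = real N - 1"
    unfolding e(1) using v_second [of K] eta(3) K(2) a by linarith+
  show "vx (2 * K + 3) = N" "vy (2 * K + 3) = N"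
    unfolding e(2) v_Suc 1 by (simp_all add: sx_def sy_def)
qed

text \<open>The horizontal part comes first, so between its ends the ladder runs strictly below the
  diagonal; this separates it from rows 2 and higher and from the gadgets.\<close>

lemma v_sag: 
  assumes "2 \<le> k" "k \<le> 2 * K + 1"
  shows "vy k < vx k"
proof (cases "k \<le> K + 1")
  case True
  then obtain l where "k = Suc l" "l \<le> K" "1 \<le> l" using assms by (cases k) auto
  then show ?thesis using v_first [of l] by (simp add: algebra_simps)
next
  case False
  then obtain l where l: "k = K + 2 + l" using le_Suc_ex [of "K + 2" k] by auto
  then have "l < K" using assms by simp
  then show ?thesis unfolding l using v_second [of l] by (simp add: algebra_simps)
qed

end

text \<open>All sites but the slack ladder are drawn at \<open>(i - e, i + f)\<close> for a column \<open>i\<close> and heights \<open>e\<close> and \<open>f\<close>.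
  The frame has \<open>e = f\<close>; teeth and patches are compressed to nearly vertical strips, which leaves room for one of
  them between the rows.\<close>

fun draw_x :: "nat \<Rightarrow> (nat \<Rightarrow> nat) \<Rightarrow> (nat \<Rightarrow> nat) \<Rightarrow> vert \<Rightarrow> real" where
  "draw_x N ca cb (Frame i j) = real i - real j"
| "draw_x N ca cb (Slack k b) = slack_path.vx N k - real b"
| "draw_x N ca cb (Tooth t c r) = real (ca t) + real c - (3 + real r / 10)"
| "draw_x N ca cb (Patch t c r) = real (cb t) + real c - (40 - real r / 10)"
| "draw_x N ca cb (Tail k) = - 1 - real k"

fun draw_y :: "nat \<Rightarrow> (nat \<Rightarrow> nat) \<Rightarrow> (nat \<Rightarrow> nat) \<Rightarrow> vert \<Rightarrow> real" where
  "draw_y N ca cb (Frame i j) = real i + real j"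
| "draw_y N ca cb (Slack k b) = slack_path.vy N k + real b"
| "draw_y N ca cb (Tooth t c r) = real (ca t) + real c + (3 + 3 * real r / 5)"
| "draw_y N ca cb (Patch t c r) = real (cb t) + real c + (40 - 3 * real r / 5)"
| "draw_y N ca cb (Tail k) = - 1 - real k"

text \<open>A numbering of the constructors that halves the case analysis in
  \<open>drawing_correct\<close> by symmetry.\<close>

fun kind :: "vert \<Rightarrow> nat" where
  "kind (Frame i j) = 0" | "kind (Slack k b) = 1" | "kind (Tooth t c r) = 2" | "kind (Patch t c r) = 3" | "kind (Tail k) = 4"

lemma consec_commute: "consec a b \<longleftrightarrow> consec b a"
  by (auto simp: consec_def)

lemma adj_commute: "adj N ca cb u v \<longleftrightarrow> adj N ca cb v u"
  by (auto simp: adj_def)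

text \<open>No tooth and patch share a place. The gaps leave room for the columns of a gadget (2 or
  425) and for its slant; the outer bounds keep gadgets away from the vertical strips.\<close>

locale matched = slack_path +
  fixes m T :: nat and ca cb :: "nat \<Rightarrow> nat"
  assumes ca: "\<And>t. t < m \<Longrightarrow> 400 \<le> ca t \<and> ca t + 400 \<le> N"
    and cb: "\<And>t. t < m \<Longrightarrow> 400 \<le> cb t \<and> cb t + 600 \<le> N"
    and ca_ca: "\<And>s t. s < t \<Longrightarrow> t < m \<Longrightarrow> ca s + 100 \<le> ca t"
    and cb_cb: "\<And>s t. s < t \<Longrightarrow> t < m \<Longrightarrow> cb s + 500 \<le> cb t"
    and ca_cb: "\<And>s t. s < m \<Longrightarrow> t < m \<Longrightarrow> ca s + 100 \<le> cb t \<or> cb t + 500 \<le> ca s"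
begin

section \<open>Adjacency in the drawing, by kinds of sites\<close>

abbreviation nr where "nr \<equiv> near (draw_x N ca cb) (draw_y N ca cb)"
abbreviation lk where "lk \<equiv> link N ca cb"
abbreviation ok where "ok \<equiv> valid_site N m T"

text \<open>Lines of constant \<open>y - x\<close> run parallel to the rows, so this separates
  objects that lie in different bands along the diagonal.\<close>

lemma not_nr_diff:
  assumes "\<bar>(draw_y N ca cb u - draw_x N ca cb u) - (draw_y N ca cb v - draw_x N ca cb v)\<bar> > 2"
  shows "\<not> nr u v"
  using assms unfolding near_def by linarith

lemma Frame_Frame: "nr (Frame i j) (Frame i' j') \<longleftrightarrow> Frame i j = Frame i' j' \<or> lk (Frame i j) (Frame i' j')"
proof -
  define a where "a = int i - int i'"
  define b where "b = int j - int j'"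
  have "nr (Frame i j) (Frame i' j') \<longleftrightarrow> \<bar>real_of_int (a - b)\<bar> \<le> 1 \<and> \<bar>real_of_int (a + b)\<bar> \<le> 1"
    by (simp add: near_def a_def b_def algebra_simps)
  also have "\<dots> \<longleftrightarrow> \<bar>a - b\<bar> \<le> 1 \<and> \<bar>a + b\<bar> \<le> 1" by linarith
  also have "\<dots> \<longleftrightarrow> a = 0 \<and> \<bar>b\<bar> \<le> 1 \<or> b = 0 \<and> \<bar>a\<bar> \<le> 1" by presburger
  also have "\<dots> \<longleftrightarrow> i = i' \<and> (j = j' \<or> consec j j') \<or> j = j' \<and> (i = i' \<or> consec i i')"
    unfolding a_def b_def consec_def by linarith
  finally show ?thesis by auto
qed

lemma Tail_Tail: "nr (Tail k) (Tail k') \<longleftrightarrow> k = k' \<or> lk (Tail k) (Tail k')"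
proof -
  have "nr (Tail k) (Tail k') \<longleftrightarrow> \<bar>real_of_int (int k - int k')\<bar> \<le> 1" by (auto simp: near_def)
  also have "\<dots> \<longleftrightarrow> \<bar>int k - int k'\<bar> \<le> 1" by linarith
  also have "\<dots> \<longleftrightarrow> k = k' \<or> k = Suc k' \<or> k' = Suc k" by presburger
  finally show ?thesis by (simp add: consec_def)
qed

lemma Frame_Tail: "nr (Frame i j) (Tail k) \<longleftrightarrow> lk (Frame i j) (Tail k)"
  by (auto simp: near_def)

lemma Slack_Slack:
  assumes "k \<le> 2 * K + 3" "k' \<le> 2 * K + 3" "b \<le> 1" "b' \<le> 1"
  shows "nr (Slack k b) (Slack k' b') \<longleftrightarrow> Slack k b = Slack k' b' \<or> lk (Slack k b) (Slack k' b')"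
proof -
  have less: "nr (Slack k b) (Slack k' b') \<longleftrightarrow> b = b' \<and> k' = Suc k"
    if "k < k'" "k' \<le> 2 * K + 3" "b \<le> 1" "b' \<le> 1" for k k' b b'
  proof -
    note v = v_less [OF that(1)] v_apart [OF that(1,2)]
    have "b = 0 \<or> b = 1" "b' = 0 \<or> b' = 1" using that by auto
    then show ?thesis using v by (auto simp: near_def)
  qed
  consider "k < k'" | "k' < k" | "k = k'" by linarith
  then show ?thesis
  proof cases
    case 1 then show ?thesis using less [OF 1 assms(2-4)] by (auto simp: consec_def)
  next
    case 2 then show ?thesis using less [OF 2 assms(1,4,3)]
      by (auto simp: consec_def near_commute [of _ _ "Slack k b" "Slack k' b'"])
  next
    case 3 
    have "b = 0 \<or> b = 1" "b' = 0 \<or> b' = 1" using assms by auto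
    then show ?thesis using 3 by (auto simp: near_def consec_def)
  qed
qed

lemma Frame_Slack:
  assumes "ok (Frame i j)" "ok (Slack k b)"
  shows "nr (Frame i j) (Slack k b) \<longleftrightarrow> lk (Frame i j) (Slack k b)"
proof -
  have k: "2 \<le> k" "k \<le> 2 * K + 1" "b \<le> 1" using assms K(3) by auto
  have sag: "vy k < vx k" using v_sag k by blast
  show ?thesis
  proof (cases "2 \<le> j")
    case True
    then have "\<not> nr (Frame i j) (Slack k b)" using sag k(3) by (intro not_nr_diff) auto
    then show ?thesis using True k(3) by auto
  next
    case False
    \<comment> \<open>In rows 0 and 1 the frame consists of the end rungs of the slack ladder, drawn
      by the same formula, so \<open>Slack_Slack\<close> applies to them.\<close>
    have eq: "nr (Frame i j) (Slack k b) \<longleftrightarrow> j = b \<and> consec l k"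
      if "vx l = real i" "vy l = real i" "l \<le> 2 * K + 3" "l \<noteq> k" for l
    proof -
      have "nr (Frame i j) (Slack k b) \<longleftrightarrow> nr (Slack l j) (Slack k b)" using that by (simp add: near_def)
      then show ?thesis using Slack_Slack [of l k j b] k that False by auto
    qed
    have "i = 0 \<or> i = 1 \<or> Suc i = N \<or> i = N" using assms False by auto
    then show ?thesis
    proof (elim disjE)
      assume "i = 0" then show ?thesis using eq [of 0] v_ends k by (auto simp: consec_def)
    next
      assume "i = 1" then show ?thesis using eq [of 1] v_ends k N5 K(3) by (auto simp: consec_def)
    next
      assume i: "Suc i = N"
      then have "real i = real N - 1" by linarith
      then show ?thesis using eq [of "2 * K + 2"] v_ends k i N5 K(3) by (auto simp: consec_def)
    next
      assume "i = N" then show ?thesis using eq [of "2 * K + 3"] v_ends k N5 K(3) by (auto simp: consec_def)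
    qed
  qed
qed

lemma Slack_Tail:
  assumes "ok (Slack k b)"
  shows "\<not> nr (Slack k b) (Tail l)"
proof -
  have "1 < vy k" using v_less(2) [of 1 k] v_ends assms by simp
  then show ?thesis by (simp add: near_def)
qed

lemma Slack_Tooth:
  assumes "ok (Slack k b)"
  shows "\<not> nr (Slack k b) (Tooth t c r)"
  using v_sag [of k] assms K(3) by (intro not_nr_diff) auto

lemma Slack_Patch:
  assumes "ok (Slack k b)" "ok (Patch t c r)"
  shows "\<not> nr (Slack k b) (Patch t c r)"
proof -
  have "real b \<le> 1" "real r \<le> 100" using assms by auto
  then show ?thesis using v_sag [of k] assms K(3) by (intro not_nr_diff) auto
qed

text \<open>Gadget rows rise by \<open>3 / 5\<close>, at most 1 for one step and more than 1 for
  two. A hundred rows use \<open>60 + 10\<close> of the 74 units of \<open>y - x\<close> between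
  rows 3 and 40.\<close>

lemma scaled_consec:
  assumes "1 \<le> r"
  shows "3 * real r / 5 \<le> 1 \<longleftrightarrow> r = 1" 
  using assms by (cases "r = 1") auto

text \<open>The height shifts the two coordinates in opposite directions, so a difference of columns
  of either sign violates one of the two bounds.\<close>

lemma comparable:
  fixes i i' :: nat and e f :: real
  assumes "0 < e" "0 < f" "e \<le> f"
  shows "\<bar>real i - real i' + e\<bar> \<le> 1 \<and> \<bar>real i - real i' - f\<bar> \<le> 1 \<longleftrightarrow> i = i' \<and> f \<le> 1"
proof -
  consider "i = i'" | "i + 1 \<le> i'" | "i' + 1 \<le> i" by linarith
  then show ?thesis
  proof cases
    case 1 then show ?thesis using assms by auto
  next
    case 2 then have "real i + 1 \<le> real i'" by linarith
    then show ?thesis using assms by auto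
  next
    case 3 then have "real i' + 1 \<le> real i" by linarith
    then show ?thesis using assms by auto
  qed
qed

lemma Frame_Tooth:
  assumes "ok (Frame i j)" "ok (Tooth t c r)"
  shows "nr (Frame i j) (Tooth t c r) \<longleftrightarrow> lk (Frame i j) (Tooth t c r)"
proof -
  have r: "1 \<le> r" "r \<le> 100" "t < m" "c \<le> 1" using assms by auto
  have rr: "1 \<le> real r" "real r \<le> 100" using r by auto
  consider "j = 3" | "j = 2" | "40 \<le> j" | "i \<le> 1 \<or> N \<le> Suc i" using assms by fastforce
  then show ?thesis
  proof cases
    case 1
    have "nr (Frame i j) (Tooth t c r) \<longleftrightarrow> i = ca t + c \<and> 3 * real r / 5 \<le> 1"
      using comparable [of "real r / 10" "3 * real r / 5" i "ca t + c"] rr 1 by (simp add: near_def algebra_simps)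
    then show ?thesis using scaled_consec r 1 by auto
  next
    case 2
    have "nr (Frame i j) (Tooth t c r) \<longleftrightarrow> i = ca t + c \<and> 1 + 3 * real r / 5 \<le> 1"
      using comparable [of "1 + real r / 10" "1 + 3 * real r / 5" i "ca t + c"] rr 2 by (simp add: near_def algebra_simps)
    then show ?thesis using rr 2 by auto
  next
    case 3
    then have "40 \<le> real j" by simp
    then show ?thesis using rr 3 not_nr_diff [of "Frame i j" "Tooth t c r"] by auto
  next
    case 4
    have j: "real j \<le> 41" using assms by auto
    have "real i + 100 \<le> real (ca t) \<or> real (ca t) + 100 \<le> real i" using 4 ca [OF r(3)] by auto
    moreover have "real c \<le> 1" using r by simp
    ultimately have "\<not> nr (Frame i j) (Tooth t c r)" using rr j unfolding near_def by auto
    then show ?thesis using 4 ca [OF r(3)] r by auto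
  qed
qed

lemma Frame_Patch:
  assumes "ok (Frame i j)" "ok (Patch t c r)"
  shows "nr (Frame i j) (Patch t c r) \<longleftrightarrow> lk (Frame i j) (Patch t c r)"
proof -
  have r: "1 \<le> r" "r \<le> 100" "t < m" "c \<le> 424" using assms by auto
  have rr: "1 \<le> real r" "real r \<le> 100" using r by auto
  consider "j = 40" | "j = 41" | "j \<le> 3" | "i \<le> 1 \<or> N \<le> Suc i" using assms by fastforce
  then show ?thesis
  proof cases
    case 1
    have "nr (Frame i j) (Patch t c r) \<longleftrightarrow> cb t + c = i \<and> 3 * real r / 5 \<le> 1"
    proof -
      have "draw_x N ca cb (Patch t c r) - draw_x N ca cb (Frame i j) = real (cb t + c) - real i + (real r / 10)"
        "draw_y N ca cb (Patch t c r) - draw_y N ca cb (Frame i j) = real (cb t + c) - real i - (3 * real r / 5)"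
        using 1 by simp_all
      then show ?thesis unfolding near_commute [of _ _ "Frame i j"] using 1 rr
        by (simp only: near_def) (rule comparable; simp)
    qed
    then show ?thesis using scaled_consec r 1 by auto
  next
    case 2
    have "nr (Frame i j) (Patch t c r) \<longleftrightarrow> cb t + c = i \<and> 1 + 3 * real r / 5 \<le> 1"
    proof -
      have "draw_x N ca cb (Patch t c r) - draw_x N ca cb (Frame i j) = real (cb t + c) - real i + (1 + real r / 10)"
        "draw_y N ca cb (Patch t c r) - draw_y N ca cb (Frame i j) = real (cb t + c) - real i - (1 + 3 * real r / 5)"
        using 2 by simp_all
      then show ?thesis unfolding near_commute [of _ _ "Frame i j"] using 2 rr
        by (simp only: near_def) (rule comparable; simp)
    qed
    then show ?thesis using rr 2 by auto
  next
    case 3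
    then have "real j \<le> 3" by simp
    then show ?thesis using rr 3 not_nr_diff [of "Frame i j" "Patch t c r"] by auto
  next
    case 4
    have j: "real j \<le> 41" using assms by auto
    have "real i + 100 \<le> real (cb t) \<or> real (cb t) + 500 \<le> real i" using 4 cb [OF r(3)] by auto
    moreover have "real c \<le> 424" using r by simp
    ultimately have "\<not> nr (Frame i j) (Patch t c r)" using rr j unfolding near_def by auto
    then show ?thesis using 4 cb [OF r(3)] r by auto
  qed
qed

lemma scaled_grid:
  fixes c c' r r' :: nat
  shows "\<bar>real c - real c' + (real r' - real r) / 10\<bar> \<le> 1 \<and> \<bar>real c - real c' - 3 * (real r' - real r) / 5\<bar> \<le> 1 \<longleftrightarrow>
    c = c' \<and> r = r' \<or> c = c' \<and> consec r r' \<or> r = r' \<and> consec c c'"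
proof -
  have less: "\<bar>real c - real c' + (real r' - real r) / 10\<bar> \<le> 1 \<and> \<bar>real c - real c' - 3 * (real r' - real r) / 5\<bar> \<le> 1 \<longleftrightarrow>
      c = c' \<and> r' = Suc r" if "r < r'" for c c' r r' :: nat
  proof -
    have p: "0 < (real r' - real r) / 10" "0 < 3 * (real r' - real r) / 5" "(real r' - real r) / 10 \<le> 3 * (real r' - real r) / 5"
      using that by simp_all
    have "3 * (real r' - real r) / 5 \<le> 1 \<longleftrightarrow> r' = Suc r"
      using that scaled_consec [of "r' - r"] by (auto simp: of_nat_diff)
    then show ?thesis using comparable [OF p, of c c'] by simp
  qed
  have eq: "\<bar>real c - real c'\<bar> \<le> 1 \<longleftrightarrow> c = c' \<or> consec c c'"
  proof -
    have "\<bar>real c - real c'\<bar> = \<bar>real_of_int (int c - int c')\<bar>" by simp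
    also have "\<dots> \<le> 1 \<longleftrightarrow> \<bar>int c - int c'\<bar> \<le> 1" by linarith
    finally show ?thesis unfolding consec_def by presburger
  qed
  consider "r < r'" | "r' < r" | "r = r'" by linarith
  then show ?thesis
  proof cases
    case 1 then show ?thesis using less [OF 1] by (auto simp: consec_def)
  next
    case 2
    have "\<bar>real c - real c' + (real r' - real r) / 10\<bar> = \<bar>real c' - real c + (real r - real r') / 10\<bar>"
      "\<bar>real c - real c' - 3 * (real r' - real r) / 5\<bar> = \<bar>real c' - real c - 3 * (real r - real r') / 5\<bar>" by argo+
    then show ?thesis using less [OF 2, of c' c] 2 by (auto simp: consec_def)
  next
    case 3 then show ?thesis using eq by auto
  qed
qed

lemma Tooth_Tooth:
  assumes "ok (Tooth t c r)" "ok (Tooth t' c' r')"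
  shows "nr (Tooth t c r) (Tooth t' c' r') \<longleftrightarrow> Tooth t c r = Tooth t' c' r' \<or> lk (Tooth t c r) (Tooth t' c' r')"
proof (cases "t = t'")
  case True
  have "nr (Tooth t c r) (Tooth t' c' r') \<longleftrightarrow>
     \<bar>real c - real c' + (real r' - real r) / 10\<bar> \<le> 1 \<and> \<bar>real c - real c' - 3 * (real r' - real r) / 5\<bar> \<le> 1"
  proof -
    have "draw_x N ca cb (Tooth t c r) - draw_x N ca cb (Tooth t' c' r') = real c - real c' + (real r' - real r) / 10"
      "draw_y N ca cb (Tooth t c r) - draw_y N ca cb (Tooth t' c' r') = real c - real c' - 3 * (real r' - real r) / 5"
      using True by (simp_all add: diff_divide_distrib right_diff_distrib)
    then show ?thesis by (simp only: near_def)
  qed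
  also have "\<dots> \<longleftrightarrow> c = c' \<and> r = r' \<or> c = c' \<and> consec r r' \<or> r = r' \<and> consec c c'"
    by (rule scaled_grid)
  finally show ?thesis using True by auto
next
  case False
  then have "ca t + 100 \<le> ca t' \<or> ca t' + 100 \<le> ca t" using ca_ca [of t t'] ca_ca [of t' t] assms by (auto simp: neq_iff)
  then have "real (ca t) + 100 \<le> real (ca t') \<or> real (ca t') + 100 \<le> real (ca t)" by linarith
  moreover have "real c \<le> 1" "real c' \<le> 1" "real r \<le> 100" "real r' \<le> 100" using assms by auto
  ultimately have "\<not> nr (Tooth t c r) (Tooth t' c' r')" unfolding near_def by auto
  then show ?thesis using False by auto
qed

lemma Patch_Patch:
  assumes "ok (Patch t c r)" "ok (Patch t' c' r')"
  shows "nr (Patch t c r) (Patch t' c' r') \<longleftrightarrow> Patch t c r = Patch t' c' r' \<or> lk (Patch t c r) (Patch t' c' r')"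
proof (cases "t = t'")
  case True
  have "nr (Patch t c r) (Patch t' c' r') \<longleftrightarrow>
     \<bar>real c - real c' + (real r - real r') / 10\<bar> \<le> 1 \<and> \<bar>real c - real c' - 3 * (real r - real r') / 5\<bar> \<le> 1"
  proof -
    have "draw_x N ca cb (Patch t c r) - draw_x N ca cb (Patch t' c' r') = real c - real c' + (real r - real r') / 10"
      "draw_y N ca cb (Patch t c r) - draw_y N ca cb (Patch t' c' r') = real c - real c' - 3 * (real r - real r') / 5"
      using True by (simp_all add: diff_divide_distrib right_diff_distrib)
    then show ?thesis by (simp only: near_def)
  qed
  also have "\<dots> \<longleftrightarrow> c = c' \<and> r' = r \<or> c = c' \<and> consec r' r \<or> r' = r \<and> consec c c'"
    by (rule scaled_grid)
  finally show ?thesis using True consec_commute [of r' r] by auto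
next
  case False
  then have "cb t + 500 \<le> cb t' \<or> cb t' + 500 \<le> cb t" using cb_cb [of t t'] cb_cb [of t' t] assms by (auto simp: neq_iff)
  then have "real (cb t) + 500 \<le> real (cb t') \<or> real (cb t') + 500 \<le> real (cb t)" by linarith
  moreover have "real c \<le> 424" "real c' \<le> 424" "real r \<le> 100" "real r' \<le> 100" using assms by auto
  ultimately have "\<not> nr (Patch t c r) (Patch t' c' r')" unfolding near_def by auto
  then show ?thesis using False by auto
qed

lemma Tooth_Patch:
  assumes "ok (Tooth t c r)" "ok (Patch t' c' r')"
  shows "\<not> nr (Tooth t c r) (Patch t' c' r')"
proof -
  have "ca t + 100 \<le> cb t' \<or> cb t' + 500 \<le> ca t" using ca_cb [of t t'] assms by auto
  then have "real (ca t) + 100 \<le> real (cb t') \<or> real (cb t') + 500 \<le> real (ca t)" by linarith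
  moreover have "real c \<le> 1" "real c' \<le> 424" "real r \<le> 100" "real r' \<le> 100" using assms by auto
  ultimately show ?thesis unfolding near_def by auto
qed

lemma Tooth_Tail: "\<not> nr (Tooth t c r) (Tail k)"
  by (auto simp: near_def)

lemma Patch_Tail:
  assumes "ok (Patch t c r)"
  shows "\<not> nr (Patch t c r) (Tail k)"
proof -
  have "400 \<le> real (cb t)" "real r \<le> 100" using cb [of t] assms by auto
  then show ?thesis by (auto simp: near_def)
qed

lemma drawing_correct:
  assumes "ok u" "ok v" "u \<noteq> v"
  shows "nr u v \<longleftrightarrow> adj N ca cb u v"
proof -
  have S: "nr (Slack k b) (Slack k' b') \<longleftrightarrow> Slack k b = Slack k' b' \<or> lk (Slack k b) (Slack k' b')"
    if "ok (Slack k b)" "ok (Slack k' b')" for k b k' b'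
    using that K(3) by (intro Slack_Slack) auto
  have half: "nr u v \<longleftrightarrow> adj N ca cb u v" if "ok u" "ok v" "u \<noteq> v" "kind u \<le> kind v" for u v
  proof -
    note pairs = Frame_Frame Tail_Tail Frame_Tail S Frame_Slack Slack_Tail Slack_Tooth Slack_Patch Frame_Tooth Frame_Patch Tooth_Tooth Patch_Patch Tooth_Patch Tooth_Tail Patch_Tail
    show ?thesis
    proof (cases u)
      case (Frame i j)
      then show ?thesis using that
        by (cases v) (auto simp: adj_def pairs consec_commute simp del: valid_site.simps)
    next
      case (Slack k b)
      then show ?thesis using that
        by (cases v) (auto simp: adj_def pairs consec_commute simp del: valid_site.simps)
    next
      case (Tooth t c r)
      then show ?thesis using that
        by (cases v) (auto simp: adj_def pairs consec_commute simp del: valid_site.simps)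
    next
      case (Patch t c r)
      then show ?thesis using that
        by (cases v) (auto simp: adj_def pairs consec_commute simp del: valid_site.simps)
    next
      case (Tail k)
      then show ?thesis using that
        by (cases v) (auto simp: adj_def pairs consec_commute simp del: valid_site.simps)
    qed
  qed
  show ?thesis
  proof (cases "kind u \<le> kind v")
    case True then show ?thesis using half assms by blast
  next
    case False then show ?thesis using half [of v u] assms near_commute adj_commute by (metis nat_le_linear)
  qed
qed

end

section \<open>Bipartiteness, injectivity and connectivity\<close>

fun colour :: "vert \<Rightarrow> nat" where
  "colour (Frame i j) = i + j" | "colour (Slack k b) = k + b" | "colour (Tooth t c r) = c + r + 1"
| "colour (Patch t c r) = c + r" | "colour (Tail k) = k + 1"

text \<open>Parity 2-colours the graph, which excludes triangles. Even columns make the gadgets fit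
  the frame, and odd \<open>N\<close> makes the far end of the slack ladder fit.\<close>

lemma link_colour:
  assumes "odd N" "5 \<le> N" "\<And>t. even (ca t)" "\<And>t. even (cb t)" "link N ca cb u v"
  shows "even (colour u) \<noteq> even (colour v)"
proof -
  \<comment> \<open>This is the far end of the slack ladder: \<open>k + 15 = 4 * N\<close> with
    \<open>N = Suc i\<close>.\<close>
  have "odd k" if "11 + k = 4 * i" for k i :: nat using that by presburger
  then show ?thesis using assms
    by (cases u; cases v) (auto simp: consec_def)
qed

lemma adj_colour:
  assumes "odd N" "5 \<le> N" "\<And>t. even (ca t)" "\<And>t. even (cb t)" "adj N ca cb u v"
  shows "even (colour u) \<noteq> even (colour v)"
  using assms link_colour [of N ca cb] unfolding adj_def by blast

context matched
begin

lemma link_draw_neq: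
  assumes "ok u" "ok v" "lk u v"
  shows "draw_x N ca cb u \<noteq> draw_x N ca cb v \<or> draw_y N ca cb u \<noteq> draw_y N ca cb v"
proof -
  have S: "vx k \<noteq> vx l" if "k \<noteq> l" for k l using v_less(1) [of k l] v_less(1) [of l k] that by (metis less_irrefl neqE)
  have F1: "draw_y N ca cb (Frame i j) \<noteq> draw_y N ca cb (Slack k b)" if "ok (Slack k b)" "lk (Frame i j) (Slack k b)" for i j k b
  proof -
    have "i = 1 \<and> k = 2 \<or> real i = real N - 1 \<and> k = 2 * K + 1" "j = b" using that K(3) by auto
    then show ?thesis using v_less(2) [of 1 2] v_less(2) [of "2 * K + 1" "2 * K + 2"] v_ends by auto
  qed
  show ?thesis
  proof (cases u)
    case (Frame i j)
    show ?thesis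
    proof (cases v)
      case (Slack k b)
      then show ?thesis using F1 [of k b i j] assms(2,3) unfolding Frame by blast
    qed (use assms Frame in \<open>auto simp: consec_def\<close>)
  next
    case (Slack k b)
    then show ?thesis using assms S v_less(2) by (cases v) (auto simp: consec_def)
  qed (use assms in \<open>(cases v; auto simp: consec_def)+\<close>)
qed

text \<open>Coinciding points would be near, hence adjacent by \<open>drawing_correct\<close>; so
  only adjacent sites have to be told apart.\<close>

lemma draw_inj: "inj_on (\<lambda>u. (draw_x N ca cb u, draw_y N ca cb u)) {u. ok u}"
proof (rule inj_onI, rule ccontr)
  fix u v assume uv: "u \<in> {u. ok u}" "v \<in> {u. ok u}" "u \<noteq> v"
    "(draw_x N ca cb u, draw_y N ca cb u) = (draw_x N ca cb v, draw_y N ca cb v)"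
  then have "nr u v" by (simp add: near_def)
  then have "lk u v \<or> lk v u" using drawing_correct uv by (simp add: adj_def)
  then show False using link_draw_neq uv by force
qed

end

lemma adj_irrefl: "\<not> adj N ca cb u u"
  by (cases u) (auto simp: adj_def consec_def)

text \<open>A potential that drops along some edge at every site except \<open>Frame 0 0\<close>.
  Rows 0 and 1 of the right strip first have to climb to row 2, hence their correction;
  \<open>N + 100\<close> exceeds all values on the frame.\<close>

fun rank :: "nat \<Rightarrow> vert \<Rightarrow> nat" where
  "rank N (Frame i j) = (if j < 2 \<and> 2 \<le> i then i + 10 - j else i + j)"
| "rank N (Slack k b) = N + 100 + k"
| "rank N (Tooth t c r) = N + 100 + r"
| "rank N (Patch t c r) = N + 100 + r"
| "rank N (Tail k) = k + 1"

lemma ex_lower_rank: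
  assumes "valid_site N m T u" "u \<noteq> Frame 0 0" "1000 \<le> N"
    and "\<And>t. t < m \<Longrightarrow> ca t + 1 \<le> N" "\<And>t. t < m \<Longrightarrow> cb t + 424 \<le> N"
  shows "\<exists>w. valid_site N m T w \<and> adj N ca cb u w \<and> rank N w < rank N u"
proof (cases u)
  case (Frame i j)
  have "j \<le> 41" "i = 0 \<longrightarrow> 1 \<le> j" using assms(1,2) Frame by auto
  then consider "i = 0" "1 \<le> j" | "i = 1" | "2 \<le> i" "j = 2 \<or> j = 3 \<or> j = 40 \<or> j = 41"
    | "2 \<le> i" "4 \<le> j" "j < 40" | "2 \<le> i" "j < 2"
    by linarith
  then show ?thesis
  proof cases
    case 1 then show ?thesis using assms Frame
      by (intro exI [of _ "Frame 0 (j - 1)"]) (auto simp: adj_def consec_def)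
  next
    case 2 then show ?thesis using assms Frame
      by (intro exI [of _ "Frame 0 j"]) (auto simp: adj_def consec_def)
  next
    case 3 then show ?thesis using assms Frame
      by (intro exI [of _ "Frame (i - 1) j"]) (auto simp: adj_def consec_def)
  next
    case 4 then show ?thesis using assms Frame
      by (intro exI [of _ "Frame i (j - 1)"]) (auto simp: adj_def consec_def)
  next
    case 5 then show ?thesis using assms Frame
      by (intro exI [of _ "Frame i (Suc j)"]) (auto simp: adj_def consec_def)
  qed
next
  case (Slack k b)
  show ?thesis
  proof (cases "k = 2")
    case True then show ?thesis using assms Slack
      by (intro exI [of _ "Frame 1 b"]) (auto simp: adj_def consec_def)
  next
    case False then show ?thesis using assms Slack
      by (intro exI [of _ "Slack (k - 1) b"]) (auto simp: adj_def consec_def)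
  qed
next
  case (Tooth t c r)
  show ?thesis
  proof (cases "r = 1")
    case True then show ?thesis using assms(1,3) assms(4) [of t] Tooth
      by (intro exI [of _ "Frame (ca t + c) 3"]) (auto simp: adj_def consec_def)
  next
    case False then show ?thesis using assms(1) Tooth
      by (intro exI [of _ "Tooth t c (r - 1)"]) (auto simp: adj_def consec_def)
  qed
next
  case (Patch t c r)
  show ?thesis
  proof (cases "r = 1")
    case True then show ?thesis using assms(1,3) assms(5) [of t] Patch
      by (intro exI [of _ "Frame (cb t + c) 40"]) (auto simp: adj_def consec_def)
  next
    case False then show ?thesis using assms(1) Patch
      by (intro exI [of _ "Patch t c (r - 1)"]) (auto simp: adj_def consec_def)
  qed
next
  case (Tail k)
  show ?thesis
  proof (cases "k = 0")
    case True then show ?thesis using assms(1) Tail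
      by (intro exI [of _ "Frame 0 0"]) (auto simp: adj_def consec_def)
  next
    case False then show ?thesis using assms(1) Tail
      by (intro exI [of _ "Tail (k - 1)"]) (auto simp: adj_def consec_def)
  qed
qed

text \<open>The side with the patches. Only four edges leave it, along rows 40 and 41 near their two
  ends, so the boundary has eight vertices.\<close>

fun far_side :: "nat \<Rightarrow> vert \<Rightarrow> bool" where
  "far_side N (Frame i j) \<longleftrightarrow> 2 \<le> i \<and> i + 2 \<le> N \<and> 40 \<le> j"
| "far_side N (Patch t c r) \<longleftrightarrow> True"
| "far_side N _ \<longleftrightarrow> False"

lemma adj_near_side:
  assumes "valid_site N m T u" "valid_site N m T v" "\<not> far_side N u"
    and "\<And>t. t < m \<Longrightarrow> 2 \<le> cb t \<and> cb t + 426 \<le> N" "\<And>t. t < m \<Longrightarrow> 2 \<le> cb' t \<and> cb' t + 426 \<le> N"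
  shows "adj N ca cb u v \<longleftrightarrow> adj N ca cb' u v"
  using assms(1-3) assms(4) assms(5)
  by (cases u; cases v) (fastforce simp: adj_def)+

lemma adj_far_side:
  assumes "far_side N u"
  shows "adj N ca cb u v \<longleftrightarrow> adj N ca' cb u v"
  using assms by (cases u; cases v) (auto simp: adj_def)

lemma adj_cross_sides:
  assumes "valid_site N m T u" "valid_site N m T v" "\<not> far_side N u" "far_side N v" "adj N ca cb u v" "1000 \<le> N"
    and "\<And>t. t < m \<Longrightarrow> 2 \<le> cb t \<and> cb t + 426 \<le> N"
  shows "u \<in> case_prod Frame ` ({1, 2, N - 2, N - 1} \<times> {40, 41}) \<and> v \<in> case_prod Frame ` ({1, 2, N - 2, N - 1} \<times> {40, 41})"
proof -
  obtain i j where u: "u = Frame i j" using assms(1-5,7) by (cases u; cases v) (fastforce simp: adj_def)+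
  have "\<exists>i' j'. v = Frame i' j'" using assms u by (cases v) (fastforce simp: adj_def)+
  then obtain i' j' where v: "v = Frame i' j'" by blast
  have d: "i = i' \<and> consec j j' \<or> j = j' \<and> consec i i'"
    using assms(5) by (auto simp: u v adj_def consec_commute)
  have o: "i \<le> N" "i \<le> 1 \<or> N \<le> Suc i \<or> j = 2 \<or> j = 3 \<or> j = 40 \<or> j = 41" "j' \<le> 41"
    and f: "2 \<le> i'" "i' + 2 \<le> N" "40 \<le> j'" "\<not> (2 \<le> i \<and> i + 2 \<le> N \<and> 40 \<le> j)"
    using assms(1-4) by (auto simp: u v)
  have "j = j' \<and> (i = 1 \<and> i' = 2 \<or> i = N - 1 \<and> i' = N - 2)"
    using d o f assms(6) unfolding consec_def by linarith
  moreover have "j' = 40 \<or> j' = 41" using o(3) f(3) by linarith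
  ultimately show ?thesis by (auto simp: u v)
qed

section \<open>Number of sites\<close>

lemma sites_subset: "{u. valid_site N m 0 u} \<subseteq> case_prod Frame ` ({..N} \<times> {..41}) \<union> case_prod Slack ` ({..4 * N} \<times> {..1}) \<union>
    (\<lambda>(t, c, r). Tooth t c r) ` ({..<m} \<times> {..1} \<times> {..100}) \<union> (\<lambda>(t, c, r). Patch t c r) ` ({..<m} \<times> {..424} \<times> {..100})"
  (is "_ \<subseteq> ?R")
proof
  fix u assume "u \<in> {u. valid_site N m 0 u}"
  then show "u \<in> ?R" by (cases u) (auto simp: image_iff)
qed

lemma finite_sites0: "finite {u. valid_site N m 0 u}"
  by (rule finite_subset [OF sites_subset]) auto

lemma card_sites0: "card {u. valid_site N m 0 u} \<le> (N + 1) * 42 + (4 * N + 1) * 2 + m * 202 + m * 42925"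
proof -
  have i: "card (f ` A) \<le> k" if "finite A" "card A = k" for f :: "'x \<Rightarrow> vert" and A k
    using card_image_le [OF that(1), of f] that(2) by simp
  have "card {u. valid_site N m 0 u} \<le> card (case_prod Frame ` ({..N} \<times> {..41}) \<union> case_prod Slack ` ({..4 * N} \<times> {..1}) \<union>
    (\<lambda>(t, c, r). Tooth t c r) ` ({..<m} \<times> {..1} \<times> {..100}) \<union> (\<lambda>(t, c, r). Patch t c r) ` ({..<m} \<times> {..424} \<times> {..100}))"
    by (rule card_mono [OF _ sites_subset]) auto
  also have "\<dots> \<le> (N + 1) * 42 + (4 * N + 1) * 2 + m * 202 + m * 42925"
    by (intro order_trans [OF card_Un_le] add_mono i) (auto simp: card_cartesian_product)
  finally show ?thesis .
qed

lemma sites_tail: "{u. valid_site N m T u} = {u. valid_site N m 0 u} \<union> Tail ` {..<T}"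
proof (intro equalityI subsetI)
  fix u assume "u \<in> {u. valid_site N m T u}" then show "u \<in> {u. valid_site N m 0 u} \<union> Tail ` {..<T}" by (cases u) auto
next
  fix u assume "u \<in> {u. valid_site N m 0 u} \<union> Tail ` {..<T}" then show "u \<in> {u. valid_site N m T u}" by (cases u) auto
qed

lemma card_sites: "finite {u. valid_site N m T u}" "card {u. valid_site N m T u} = card {u. valid_site N m 0 u} + T"
proof -
  have "card (Tail ` {..<T}) = T" by (subst card_image) (auto simp: inj_on_def)
  moreover have "{u. valid_site N m 0 u} \<inter> Tail ` {..<T} = {}" by auto
  ultimately show "finite {u. valid_site N m T u}" "card {u. valid_site N m T u} = card {u. valid_site N m 0 u} + T"
    unfolding sites_tail [of N m T] using finite_sites0 [of N m] by (simp_all add: card_Un_disjoint)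
qed

text \<open>A slot has two places 600 apart. The tooth takes the second one iff
  \<open>t \<in> x\<close>, the patch of \<open>patch_col\<close> the first one iff
  \<open>t \<in> y\<close>, so they meet exactly when the bits differ. There
  \<open>488 = 700 - 212\<close> centres the patch over the tooth.\<close>

definition tooth_col :: "nat set \<Rightarrow> nat \<Rightarrow> nat" where
  "tooth_col x t = 700 + 600 * (2 * t + (if t \<in> x then 1 else 0))"

definition patch_col :: "nat set \<Rightarrow> nat \<Rightarrow> nat" where
  "patch_col y t = 488 + 600 * (2 * t + (if t \<in> y then 0 else 1))"

lemma matched_cols: "matched (1200 * m + 1401) m (tooth_col x) (patch_col x)"
proof unfold_locales
  fix s t :: nat
  consider "Suc s \<le> t" | "s = t" | "Suc t \<le> s" by linarith
  then show "tooth_col x s + 100 \<le> patch_col x t \<or> patch_col x t + 500 \<le> tooth_col x s"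
    by cases (auto simp: tooth_col_def patch_col_def)
qed (auto simp: tooth_col_def patch_col_def)

lemma mismatch:
  assumes drawn: "\<And>u v. valid_site N m T u \<Longrightarrow> valid_site N m T v \<Longrightarrow> u \<noteq> v \<Longrightarrow>
      near X Y u v \<longleftrightarrow> adj N (tooth_col x) (patch_col y) u v"
    and Nm: "N = 1200 * m + 1401" and t: "t < m" "t \<in> x \<longleftrightarrow> t \<notin> y"
  shows False
proof -
  have n: "near X Y u v \<longleftrightarrow> adj N (tooth_col x) (patch_col y) u v"
    if "u \<in> {Frame 0 0, Frame 1 0, Frame 1 1, Frame 0 1}" "v \<in> {Frame 0 0, Frame 1 0, Frame 1 1, Frame 0 1}" "u \<noteq> v" for u v
    using that Nm by (intro drawn) auto
  obtain X' Y' where XY: "tilted X' Y' (Frame 0 0) (Frame 1 0) (Frame 1 1) (Frame 0 1)" "near X' Y' = near X Y"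
    by (rule ex_tilted [of X Y "Frame 0 0" "Frame 1 0" "Frame 1 1" "Frame 0 1"]) (auto simp: n adj_def consec_def)
  interpret tilted_drawing X' Y' N m T "tooth_col x" "patch_col y"
    by unfold_locales (use XY drawn Nm in auto)
  show False
    by (rule no_conflict [OF t(1)]) (use t Nm in \<open>auto simp: tooth_col_def patch_col_def\<close>)
qed

text \<open>Matched strings give triangle-free unit-square graphs and mismatched ones not even
  unit-square graphs, so one fooling set serves every class in between.\<close>

lemma lower_bound:
  fixes cls :: "nat set \<Rightarrow> (nat \<Rightarrow> nat \<Rightarrow> bool) \<Rightarrow> bool"
  assumes c: "c \<ge> 1"
    and sub: "\<And>V E. triangle_free_unit_square_graph V E \<Longrightarrow> cls V E"
    and sup: "\<And>V E. cls V E \<Longrightarrow> unit_square_graph V E"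
    and pls: "pls_correct cls c A P"
    and len: "\<And>V E v. graph_ok c V E \<Longrightarrow> card V = n \<Longrightarrow> cls V E \<Longrightarrow> v \<in> V \<Longrightarrow> length (P V E v) \<le> s"
    and n: "n \<ge> 220000"
  shows "n \<le> 110000 * (8 * s + 10)"
proof -
  \<comment> \<open>Without its tail the graph has at most
    \<open>103127 * m + 70094 \<le> 110000 * (m + 1)\<close> sites, so this many slots fit into
    \<open>n\<close> vertices.\<close>
  define m where "m = n div 110000 - 1"
  define N where "N = 1200 * m + 1401"
  have m: "110000 * (m + 1) \<le> n" "n < 110000 * (m + 2)" using n by (auto simp: m_def)
  define T where "T = n - card {u. valid_site N m 0 u}"
  have "card {u. valid_site N m 0 u} \<le> 110000 * (m + 1)"
    using card_sites0 [of N m] by (simp add: N_def)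
  then have card: "card {u. valid_site N m T u} = n" using card_sites [of N m T] m by (simp add: T_def)
  obtain h where h: "bij_betw h {u. valid_site N m T u} {1..n}"
    using card_sites(1) [of N m T] card finite_same_card_bij [of "{u. valid_site N m T u}" "{1..n}"] by auto
  define g where "g = inv_into {u. valid_site N m T u} h"
  have g: "bij_betw g {1..n} {u. valid_site N m T u}" unfolding g_def by (rule bij_betw_inv_into [OF h])
  have okg: "valid_site N m T (g a)" if "a \<in> {1..n}" for a using g that by (auto simp: bij_betw_def)
  have gh: "g (h u) = u" "h u \<in> {1..n}" if "valid_site N m T u" for u
    using h that by (auto simp: g_def bij_betw_def)
  have g_eq: "g a = g b \<longleftrightarrow> a = b" if "a \<in> {1..n}" "b \<in> {1..n}" for a b
    using g that by (auto simp: bij_betw_def inj_on_eq_iff)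
  define EG where "EG x y a b \<longleftrightarrow> a \<in> {1..n} \<and> b \<in> {1..n} \<and> adj N (tooth_col x) (patch_col y) (g a) (g b)" for x y a b
  define S where "S = {a. \<not> far_side N (g a)}"
  define B where "B = case_prod Frame ` ({1, 2, N - 2, N - 1} \<times> {40, 41 :: nat})"
  have cols: "tooth_col x t + 400 \<le> N" "2 \<le> patch_col y t" "patch_col y t + 426 \<le> N" if "t < m" for x y t
    using that by (auto simp: tooth_col_def patch_col_def N_def)
  have N1: "1000 \<le> N" by (simp add: N_def)
  have B_ok: "valid_site N m T u" if "u \<in> B" for u using that N1 by (auto simp: B_def)
  have "card (Pow {..<m}) \<le> 2 ^ ((s + 1) * card (h ` B))"
  proof (rule fooling_set_bound [OF pls, of "Pow {..<m}" "{1..n}" EG S "h ` B" s])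
    show ok: "graph_ok c {1..n} (EG x y)" for x y
    proof -
      have "n ^ 1 \<le> n ^ c" using n c by (intro power_increasing) auto
      then have 1: "{1..n} \<subseteq> {1..card {1..n} ^ c}" "{1..n} \<noteq> {}" using n by auto
      have sym: "EG x y a b \<Longrightarrow> EG x y b a" for a b by (simp add: EG_def adj_commute)
      define r where "r = h (Frame 0 0)"
      have r: "g r = Frame 0 0" "r \<in> {1..n}" using gh [of "Frame 0 0"] by (auto simp: r_def)
      have "(a, r) \<in> {(x', y'). EG x y x' y'}\<^sup>*" if "a \<in> {1..n}" for a
        using that
      proof (induction "rank N (g a)" arbitrary: a rule: less_induct)
        case less
        show ?case
        proof (cases "g a = Frame 0 0")
          case True then have "a = r" using g_eq [OF less.prems r(2)] r(1) by simp
          then show ?thesis by simp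
        next
          case False
          have "tooth_col x t + 1 \<le> N" "patch_col y t + 424 \<le> N" if "t < m" for t
            using cols(1) [OF that, of x] cols(3) [OF that, of y] by simp_all
          then obtain w where w: "valid_site N m T w" "adj N (tooth_col x) (patch_col y) (g a) w" "rank N w < rank N (g a)"
            using ex_lower_rank [OF okg [OF less.prems] False N1] by blast
          have "EG x y a (h w)" using w gh [OF w(1)] less.prems by (simp add: EG_def)
          moreover have "(h w, r) \<in> {(x', y'). EG x y x' y'}\<^sup>*"
            using less.hyps [of "h w"] w gh [OF w(1)] by simp
          ultimately show ?thesis by (meson case_prodI converse_rtrancl_into_rtrancl mem_Collect_eq)
        qed
      qed
      moreover have "(r, a) \<in> {(x', y'). EG x y x' y'}\<^sup>*" if "a \<in> {1..n}" for a
      proof -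
        have "sym ({(x', y'). EG x y x' y'}\<^sup>*)" by (rule sym_rtrancl) (auto simp: sym_def intro: sym)
        then show ?thesis using calculation [OF that] by (meson symD)
      qed
      ultimately have "\<forall>a\<in>{1..n}. \<forall>b\<in>{1..n}. (a, b) \<in> {(x', y'). EG x y x' y'}\<^sup>*"
        by (meson rtrancl_trans)
      moreover have "EG x y a b \<Longrightarrow> a \<in> {1..n} \<and> b \<in> {1..n}" "\<not> EG x y a a" for a b
        by (simp_all add: EG_def adj_irrefl)
      ultimately show ?thesis unfolding graph_ok_def using 1 sym by (intro conjI) (simp, blast+)
    qed
    show yes: "cls {1..n} (EG x x)" for x
    proof (rule sub)
      interpret matched N m T "tooth_col x" "patch_col x" unfolding N_def by (rule matched_cols)
      have "unit_square_graph {1..n} (EG x x)"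
        unfolding unit_square_graph_def
      proof (intro exI conjI ballI impI)
        let ?p = "(\<lambda>u. (draw_x N (tooth_col x) (patch_col x) u, draw_y N (tooth_col x) (patch_col x) u)) \<circ> g"
        show "inj_on ?p {1..n}" using g draw_inj by (auto simp: bij_betw_def intro!: comp_inj_on)
        fix a b assume ab: "a \<in> {1..n}" "b \<in> {1..n}" "a \<noteq> b"
        then have "nr (g a) (g b) \<longleftrightarrow> EG x x a b"
          using drawing_correct [of "g a" "g b"] okg g_eq by (auto simp: EG_def)
        then show "EG x x a b \<longleftrightarrow> \<bar>fst (?p a) - fst (?p b)\<bar> \<le> 1 \<and> \<bar>snd (?p a) - snd (?p b)\<bar> \<le> 1"
          by (simp add: near_def)
      qed
      moreover have "triangle_free {1..n} (EG x x)"
      proof -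
        have "odd N" "5 \<le> N" by (auto simp: N_def)
        moreover have "even (tooth_col x t)" "even (patch_col x t)" for t by (auto simp: tooth_col_def patch_col_def)
        ultimately have "even (colour (g a)) \<noteq> even (colour (g b))" if "EG x x a b" for a b
          using adj_colour [of N "tooth_col x" "patch_col x"] that by (simp add: EG_def)
        then show ?thesis unfolding triangle_free_def by metis
      qed
      ultimately show "triangle_free_unit_square_graph {1..n} (EG x x)"
        by (simp add: triangle_free_unit_square_graph_def)
    qed
    show "\<not> cls {1..n} (EG x y)" if xy: "x \<in> Pow {..<m}" "y \<in> Pow {..<m}" "x \<noteq> y" for x y
    proof
      assume "cls {1..n} (EG x y)"
      then have us: "unit_square_graph {1..n} (EG x y)" by (rule sup)
      obtain p where p: "realizes {1..n} (EG x y) p"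
        using us unfolding unit_square_graph_iff_realizes by blast
      obtain t where t: "t < m" "t \<in> x \<longleftrightarrow> t \<notin> y" using xy by blast
      show False
      proof (rule mismatch [OF _ N_def t])
        fix u v assume uv: "valid_site N m T u" "valid_site N m T v" "u \<noteq> v"
        then have "h u \<noteq> h v" using gh by metis
        then show "near (\<lambda>u. fst (p (h u))) (\<lambda>u. snd (p (h u))) u v \<longleftrightarrow> adj N (tooth_col x) (patch_col y) u v"
          using realizesD [OF p, of "h u" "h v"] gh uv by (simp add: near_def EG_def)
      qed
    qed
    show "EG x y u v = EG x x u v" if "u \<in> S" for x y u v
      using adj_near_side [of N m T "g u" "g v" "patch_col y" "patch_col x" "tooth_col x"] okg cols that
      by (auto simp: EG_def S_def)
    show "EG x y u v = EG y y u v" if "u \<notin> S" for x y u v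
      using adj_far_side [of N "g u" "tooth_col x" "patch_col y" "g v" "tooth_col y"] that
      by (auto simp: EG_def S_def)
    show "u \<in> h ` B \<and> v \<in> h ` B" if uv: "u \<in> S" "v \<notin> S" "EG x y u v \<or> EG x y v u" for x y u v
    proof -
      have *: "u \<in> {1..n}" "v \<in> {1..n}" "adj N (tooth_col x) (patch_col y) (g u) (g v)"
        using uv(3) by (auto simp: EG_def adj_commute)
      have "g u \<in> B \<and> g v \<in> B" unfolding B_def
        by (rule adj_cross_sides [of N m T "g u" "g v" "tooth_col x" "patch_col y"])
           (use * okg uv(1,2) N1 cols in \<open>auto simp: S_def\<close>)
      moreover have "h (g a) = a" if "a \<in> {1..n}" for a
        unfolding g_def using h that by (auto simp: bij_betw_def f_inv_into_f)
      ultimately show ?thesis using * by (metis image_eqI)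
    qed
    show "finite (h ` B)" by (simp add: B_def)
    show "h ` B \<subseteq> {1..n}" using B_ok gh by auto
    show "length (P {1..n} (EG x x) v) \<le> s" if "v \<in> {1..n}" for x v
      by (rule len [OF ok _ yes that]) simp
  qed
  then have "2 ^ m \<le> (2::nat) ^ ((s + 1) * card (h ` B))" by (simp add: card_Pow)
  then have "m \<le> (s + 1) * card (h ` B)" by simp
  moreover have "card (h ` B) \<le> 8"
  proof -
    have "card (h ` B) \<le> card B" by (rule card_image_le) (simp add: B_def)
    also have "\<dots> \<le> card ({1, 2, N - 2, N - 1} \<times> {40, 41 :: nat})" unfolding B_def by (rule card_image_le) simp
    also have "\<dots> = card {1, 2, N - 2, N - 1} * 2" by (subst card_cartesian_product) simp
    also have "\<dots> \<le> 4 * 2" by (intro mult_right_mono) (auto simp: card_insert_if)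
    finally show ?thesis by simp
  qed
  ultimately have "m \<le> (s + 1) * 8" by (meson le_trans mult_le_mono2)
  then show ?thesis using m by simp
qed

section \<open>Asymptotic bounds\<close>

lemma local_complexity_lower:
  assumes c: "c \<ge> 1"
    and sub: "\<And>V E. triangle_free_unit_square_graph V E \<Longrightarrow> cls V E"
    and sup: "\<And>V E. cls V E \<Longrightarrow> unit_square_graph V E"
    and ex: "\<exists>A P. pls_correct cls c A P \<and> (\<forall>V E. graph_ok c V E \<longrightarrow> cls V E \<longrightarrow> (\<forall>v\<in>V. length (P V E v) \<le> L (card V)))"
  shows "(\<lambda>n. real (local_complexity cls c n)) \<in> \<Omega>(\<lambda>n. real n)"
proof -
  obtain A P where AP: "pls_correct cls c A P"
    "\<forall>V E. graph_ok c V E \<longrightarrow> cls V E \<longrightarrow> (\<forall>v\<in>V. length (P V E v) \<le> L (card V))"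
    using ex by blast
  \<comment> \<open>From this \<open>n\<close> on, the additive constant \<open>1100000\<close> of
    the bound is at most \<open>n / 2\<close>, which doubles the factor
    \<open>880000\<close>.\<close>
  have "real n / 1760000 \<le> real (local_complexity cls c n)" if n: "n \<ge> 2200000" for n
  proof -
    have "\<exists>A P. pls_correct cls c A P \<and>
        (\<forall>V E. graph_ok c V E \<longrightarrow> card V = n \<longrightarrow> cls V E \<longrightarrow>
           (\<forall>v\<in>V. length (P V E v) \<le> local_complexity cls c n))"
      by (rule local_complexity_attained [OF AP(1), of n "L n"]) (use AP(2) in blast)
    then obtain A P where *: "pls_correct cls c A P"
      "\<forall>V E. graph_ok c V E \<longrightarrow> card V = n \<longrightarrow> cls V E \<longrightarrow> (\<forall>v\<in>V. length (P V E v) \<le> local_complexity cls c n)"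
      by blast
    have "n \<le> 110000 * (8 * local_complexity cls c n + 10)"
      by (rule lower_bound [OF c sub sup *(1)]) (use *(2) n in auto)
    then have "real n \<le> real (110000 * (8 * local_complexity cls c n + 10))" by (rule of_nat_mono)
    then have "real n \<le> 880000 * real (local_complexity cls c n) + 1100000" by simp
    then show ?thesis using n by simp
  qed
  then show ?thesis
    by (intro landau_omega.bigI [of "1 / 1760000"] eventually_mono [OF eventually_ge_at_top [of 2200000]]) auto
qed

theorem theorem6p7:
  fixes c :: nat
  assumes "c \<ge> 1"
  shows "(\<lambda>n. real (local_complexity triangle_free_unit_square_graph c n)) \<in> \<Theta>(\<lambda>n. real n)
       \<and> (\<lambda>n. real (local_complexity unit_square_graph c n)) \<in> \<Omega>(\<lambda>n. real n)
       \<and> (\<lambda>n. real (local_complexity unit_square_graph c n)) \<in> O(\<lambda>n. real n * ln (real n))"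
proof (intro conjI)
  obtain C where C: "\<exists>A P. pls_correct triangle_free_unit_square_graph c A P \<and>
    (\<forall>V E. graph_ok c V E \<longrightarrow> triangle_free_unit_square_graph V E \<longrightarrow>
       (\<forall>v\<in>V. length (P V E v) \<le> 2 * (2 * card V * C) + 3 * c * length (bits (card V)) + 2))"
    using ex_pls_triangle_free_unit_square [OF assms] by blast
  have "(\<lambda>n. real (local_complexity triangle_free_unit_square_graph c n)) \<in> \<Omega>(\<lambda>n. real n)"
    by (rule local_complexity_lower [OF assms _ _ C]) (auto simp: triangle_free_unit_square_graph_def)
  then show "(\<lambda>n. real (local_complexity triangle_free_unit_square_graph c n)) \<in> \<Theta>(\<lambda>n. real n)"
    using triangle_free_upper [OF assms] by (simp add: bigtheta_def)
  show "(\<lambda>n. real (local_complexity unit_square_graph c n)) \<in> \<Omega>(\<lambda>n. real n)"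
    by (rule local_complexity_lower [OF assms _ _ ex_pls_unit_square [OF assms]])
       (auto simp: triangle_free_unit_square_graph_def)
  show "(\<lambda>n. real (local_complexity unit_square_graph c n)) \<in> O(\<lambda>n. real n * ln (real n))"
    by (rule unit_square_upper [OF assms])
qed

end
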